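(* There exist universal constants $c,C,c_\epsilon>0$ and $d_0\in\mathbb N$ such that, whenever $d\ge d_0$, $R>0$, $0<\mu\le\beta$, $0<\epsilon\le c_\epsilon\beta R^2$, and, with $Q=\beta R^2/\epsilon$ and $\kappa=\beta/\mu$, $$Q\le\kappa,\qquad Q\le\left(\frac{d}{\log(ed)}\right)^{2/3},$$ one has $$c\,d\sqrt{\frac{\beta R^2}{\epsilon}}\le N_\epsilon(d,R,\mu,\beta)\le C\,d\sqrt{\frac{\beta R^2}{\epsilon}},$$ that is, $N_\epsilon(d,R,\mu,\beta)=\Theta\big(d\sqrt{\beta R^2/\epsilon}\big)$.
   Context: $B_2^d(r)$ is the closed Euclidean ball of radius $r$ centred at $0$ in $\mathbb R^d$; $X:=B_2^d(R)$. Class $\mathcal F_{\mu,\beta}(d,R)$: all continuously differentiable $f:\mathbb R^d\to\mathbb R$ such that for all $x,y\in\mathbb R^d$, $f(y)\ge f(x)+\langle\nabla f(x),y-x\rangle+\frac\mu2\|y-x\|_2^2$ and $\|\nabla f(x)-\nabla f(y)\|_2\le\beta\|x-y\|_2$, and whose unique minimizer $x_f^\star$ lies in $B_2^d(R/2)$. Write $f^\star=f(x_f^\star)$. A deterministic adaptive algorithm with budget $T$ (a $T$-call algorithm) consists of Borel maps $Q_t:(X\times\mathbb R)^{t-1}\to X$, $t=1,\dots,T$, and a Borel terminal map $Q_{\mathrm{out}}:(X\times\mathbb R)^T\to X$. On a fixed objective $f$ it generates recursively $x_t=Q_t((x_1,f(x_1)),\dots,(x_{t-1},f(x_{t-1})))$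 and outputs $\widehat x_f=Q_{\mathrm{out}}((x_1,f(x_1)),\dots,(x_T,f(x_T)))$. Minimax exact-value complexity: $N_\epsilon(d,R,\mu,\beta)$ is the infimum of all $T\in\mathbb N_0$ for which there exists a deterministic adaptive $T$-call algorithm with $\sup_{f\in\mathcal F_{\mu,\beta}(d,R)}[f(\widehat x_f)-f^\star]\le\epsilon$ (with $\inf\varnothing=+\infty$). *)

theory Defs
  imports "HOL-Analysis.Analysis"
begin

text \<open>
  The constants of the theorem do not depend on the dimension, so the dimension has to be a
  variable rather than a type. A vector of \<open>\<real>\<^sup>d\<close> is a function on the naturals that vanishes from
  index \<open>d\<close> on, i.e. a point of the library space \<^const>\<open>Euclidean_space\<close>. The type
  \<^typ>\<open>nat \<Rightarrow> real\<close> carries the product topology, whose restriction to \<open>Rd d\<close> is the usual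
  topology of \<open>\<real>\<^sup>d\<close>; hence the library's \<^term>\<open>at x within Rd d\<close>, \<^const>\<open>continuous_on\<close> and
  \<^const>\<open>borel\<close> have their usual meaning on subsets of \<open>Rd d\<close>. An objective function is only
  ever evaluated on \<open>Rd d\<close>.
\<close>

type_synonym point = "nat \<Rightarrow> real"

abbreviation Rd :: "nat \<Rightarrow> point set" where
  "Rd d \<equiv> topspace (Euclidean_space d)"

definition inner_d :: "nat \<Rightarrow> point \<Rightarrow> point \<Rightarrow> real" where
  "inner_d d x y = (\<Sum>i<d. x i * y i)"

definition norm_d :: "nat \<Rightarrow> point \<Rightarrow> real" where
  "norm_d d x = L2_set x {..<d}"

definition cball_d :: "nat \<Rightarrow> real \<Rightarrow> point set" where
  "cball_d d r = {x \<in> Rd d. norm_d d x \<le> r}"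

definition has_gradient :: "nat \<Rightarrow> (point \<Rightarrow> real) \<Rightarrow> point \<Rightarrow> point \<Rightarrow> bool" where
  "has_gradient d f g x \<longleftrightarrow> g \<in> Rd d \<and>
     ((\<lambda>y. (f y - f x - inner_d d g (y - x)) / norm_d d (y - x)) \<longlongrightarrow> 0) (at x within Rd d)"

definition objective_class :: "nat \<Rightarrow> real \<Rightarrow> real \<Rightarrow> real \<Rightarrow> (point \<Rightarrow> real) set" where
  "objective_class d R \<mu> \<beta> = {f.
     (\<exists>G. (\<forall>x\<in>Rd d. has_gradient d f (G x) x) \<and> continuous_on (Rd d) G \<and>
        (\<forall>x\<in>Rd d. \<forall>y\<in>Rd d.
           f y \<ge> f x + inner_d d (G x) (y - x) + \<mu> / 2 * (norm_d d (y - x))\<^sup>2 \<and>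
           norm_d d (G x - G y) \<le> \<beta> * norm_d d (x - y))) \<and>
     (\<exists>!x. is_arg_min f (\<lambda>x. x \<in> Rd d) x) \<and>
     arg_min_on f (Rd d) \<in> cball_d d (R / 2)}"

text \<open>
  A history of length \<open>t\<close> is the family, indexed by \<open>{..<t}\<close>, of the pairs (query, value) seen so
  far. It is extensional (\<^const>\<open>undefined\<close> outside \<open>{..<t}\<close>), as the elements of
  \<^const>\<open>PiM\<close> are. Queries are numbered from \<open>0\<close>, so \<open>Q t\<close> is the map that chooses a
  query after \<open>t\<close> answers.
\<close>

type_synonym history = "nat \<Rightarrow> point \<times> real"

definition query_space :: "nat \<Rightarrow> real \<Rightarrow> point measure" where
  "query_space d R = restrict_space borel (cball_d d R)"

definition history_space :: "nat \<Rightarrow> real \<Rightarrow> nat \<Rightarrow> history measure" where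
  "history_space d R t = PiM {..<t} (\<lambda>_. query_space d R \<Otimes>\<^sub>M borel)"

definition is_algorithm ::
  "nat \<Rightarrow> real \<Rightarrow> nat \<Rightarrow> (nat \<Rightarrow> history \<Rightarrow> point) \<Rightarrow> (history \<Rightarrow> point) \<Rightarrow> bool" where
  "is_algorithm d R T Q Qout \<longleftrightarrow>
     (\<forall>t<T. Q t \<in> measurable (history_space d R t) (query_space d R)) \<and>
     Qout \<in> measurable (history_space d R T) (query_space d R)"

primrec history :: "(nat \<Rightarrow> history \<Rightarrow> point) \<Rightarrow> (point \<Rightarrow> real) \<Rightarrow> nat \<Rightarrow> history" where
  "history Q f 0 = (\<lambda>_. undefined)"
| "history Q f (Suc t) =
     (let h = history Q f t; x = Q t h in h(t := (x, f x)))"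

definition output_point ::
  "nat \<Rightarrow> (nat \<Rightarrow> history \<Rightarrow> point) \<Rightarrow> (history \<Rightarrow> point) \<Rightarrow> (point \<Rightarrow> real) \<Rightarrow> point" where
  "output_point T Q Qout f = Qout (history Q f T)"

definition minimax_complexity :: "real \<Rightarrow> nat \<Rightarrow> real \<Rightarrow> real \<Rightarrow> real \<Rightarrow> enat" where
  "minimax_complexity \<epsilon> d R \<mu> \<beta> = Inf {enat T | T. \<exists>Q Qout. is_algorithm d R T Q Qout \<and>
     (SUP f \<in> objective_class d R \<mu> \<beta>.
        ereal (f (output_point T Q Qout f) - f (arg_min_on f (Rd d)))) \<le> ereal \<epsilon>}"

end

theory Submission
  imports Defs
begin

text \<open>
  Upper bound: exact values give forward differences of arbitrary precision, so \<open>d + 1\<close> queries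
  simulate a gradient, and projected accelerated gradient descent on the ball of radius \<open>R / 2\<close> needs
  \<open>O (sqrt Q)\<close> gradients.

  Lower bound: the hard functions are Nesterov chains \<open>\<Sum>i<N. \<phi> (z i - z (i + 1))\<close> in the
  coordinates \<open>z i\<close> of a hidden orthonormal system, with \<open>N\<close> of order \<open>sqrt Q\<close>, where \<open>\<phi>\<close>
  vanishes on a dead zone of width of order \<open>R / N powr (3 / 2)\<close>. A resisting oracle lets \<open>d div 4\<close>
  queries pass before it fixes the next direction. It chooses that direction orthogonal to these
  queries and so flat that its inner products with all earlier queries, whose number may exceed
  \<open>d\<close>, stay in the dead zone. Flatness is possible because \<open>N ^ 3 * ln d\<close> is at most of order
  \<open>d\<close>. With fewer than \<open>N * (d div 4)\<close> queries the output is orthogonal to the last direction, which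
  costs \<open>\<beta> * R ^ 2 / N ^ 2\<close> up to a constant.
\<close>

subsection \<open>Linear algebra in the first \<open>d\<close> coordinates\<close>

text \<open>The exponents come from comparing three scales. The offset s = R / (2 * sqrt N) is
  chosen so that the point whose N hidden coordinates all equal s, where every difference of the
  chain vanishes, has norm R / 2. An output whose last coordinate is 0 must spread the drop s over N
  differences, on average R / (2 * N powr (3 / 2)) each. A dead zone that swallows half of this
  still leaves a gap of order \<beta> * R^2 / N^2. On the other side, a unit vector that is flat on
  polynomially many points of norm at most R, within a space of dimension of order d, still has
  products of order R * sqrt (ln d / d) with them. The dead zone covers these if N^3 * ln d is a
  small multiple of d, which for N of order sqrt Q is the second hypothesis on Q. The first one, Q
  \<le> \<kappa>, says \<mu> * R^2 \<le> \<epsilon>, so the quadratic term that makes the chain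
  strongly convex puts the minimum at no more than \<epsilon> / 8. In the upper bound the iterates
  stay in the ball of radius R / 2, which contains the minimizer; this leaves room R / 2 for the
  difference steps inside the query ball.\<close>

lemma in_Rd_iff: "x \<in> Rd d \<longleftrightarrow> (\<forall>i\<ge>d. x i = 0)"
  by (simp add: topspace_Euclidean_space)

lemma inner_d_commute: "inner_d d x y = inner_d d y x"
  by (simp add: inner_d_def mult.commute)

lemma inner_d_diff_left: "inner_d d (x - y) z = inner_d d x z - inner_d d y z"
  by (simp add: inner_d_def left_diff_distrib sum_subtractf)

lemma inner_d_diff_right: "inner_d d z (x - y) = inner_d d z x - inner_d d z y"
  by (simp add: inner_d_def right_diff_distrib sum_subtractf)

lemma inner_d_add_left: "inner_d d (\<lambda>i. x i + y i) z = inner_d d x z + inner_d d y z"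
  by (simp add: inner_d_def distrib_right sum.distrib)

lemma inner_d_scale_left: "inner_d d (\<lambda>i. a * x i) z = a * inner_d d x z"
  by (simp add: inner_d_def sum_distrib_left mult.assoc)

lemma inner_d_sum_left: "inner_d d (\<lambda>i. \<Sum>j\<in>J. v j i) z = (\<Sum>j\<in>J. inner_d d (v j) z)"
  unfolding inner_d_def by (subst sum.swap) (simp add: sum_distrib_right)

lemma inner_d_add_right: "inner_d d z (\<lambda>i. x i + y i) = inner_d d z x + inner_d d z y"
  and inner_d_scale_right: "inner_d d z (\<lambda>i. a * x i) = a * inner_d d z x"
  and inner_d_sum_right: "inner_d d z (\<lambda>i. \<Sum>j\<in>J. v j i) = (\<Sum>j\<in>J. inner_d d z (v j))"
  by (simp_all add: inner_d_commute[of d z] inner_d_add_left inner_d_scale_left inner_d_sum_left)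

lemmas inner_d_linear = inner_d_diff_left inner_d_diff_right inner_d_add_left inner_d_add_right
  inner_d_scale_left inner_d_scale_right inner_d_sum_left inner_d_sum_right

lemma norm_d_nonneg [simp]: "0 \<le> norm_d d x"
  by (simp add: norm_d_def L2_set_nonneg)

lemma norm_d_sq: "(norm_d d x)\<^sup>2 = inner_d d x x"
  by (simp add: norm_d_def L2_set_def inner_d_def power2_eq_square sum_nonneg)

lemma norm_d_le_iff: "0 \<le> r \<Longrightarrow> norm_d d x \<le> r \<longleftrightarrow> inner_d d x x \<le> r\<^sup>2"
  by (metis norm_d_sq norm_d_nonneg power2_le_imp_le power_mono)

lemma norm_d_diff_commute: "norm_d d (x - y) = norm_d d (y - x)"
  by (simp add: norm_d_def L2_set_def power2_commute)

lemma abs_inner_d_le: "\<bar>inner_d d x y\<bar> \<le> norm_d d x * norm_d d y"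
proof -
  have "\<bar>inner_d d x y\<bar> \<le> (\<Sum>i<d. \<bar>x i\<bar> * \<bar>y i\<bar>)"
    unfolding inner_d_def by (rule order_trans[OF sum_abs]) (simp add: abs_mult)
  also have "\<dots> \<le> norm_d d x * norm_d d y"
    unfolding norm_d_def by (rule L2_set_mult_ineq)
  finally show ?thesis .
qed

lemma inner_d_le: "inner_d d x y \<le> norm_d d x * norm_d d y"
  using abs_inner_d_le[of d x y] by linarith

lemma norm_d_eq_0_iff: "x \<in> Rd d \<Longrightarrow> norm_d d x = 0 \<longleftrightarrow> x = (\<lambda>_. 0)"
  by (force simp: norm_d_def L2_set_eq_0_iff in_Rd_iff fun_eq_iff not_le)

lemma norm_d_triangle: "norm_d d (\<lambda>i. x i + y i) \<le> norm_d d x + norm_d d y"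
  unfolding norm_d_def by (rule L2_set_triangle_ineq)

lemma norm_d_scale: "norm_d d (\<lambda>i. a * x i) = \<bar>a\<bar> * norm_d d x"
  by (simp add: norm_d_def L2_set_def power_mult_distrib real_sqrt_mult flip: sum_distrib_left)

lemma component_le_norm_d: "i < d \<Longrightarrow> \<bar>x i\<bar> \<le> norm_d d x"
  using member_le_L2_set[of "{..<d}" i "\<lambda>i. \<bar>x i\<bar>"] by (simp add: norm_d_def L2_set_def)

lemma continuous_on_norm_d: "continuous_on S (norm_d d)"
  unfolding norm_d_def L2_set_def
  by (intro continuous_intros continuous_on_subset[OF continuous_on_product_coordinates]) simp

lemma compact_cball_d: "compact (cball_d d r)"
proof -
  let ?B = "PiE UNIV (\<lambda>i::nat. if i < d then {-r..r} else {0::real})"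
  have "compactin (product_topology (\<lambda>_. euclidean) UNIV) ?B"
    by (subst compactin_PiE) auto
  then have B: "compact ?B"
    by (simp add: euclidean_product_topology)
  have "cball_d d r = ?B \<inter> {x. norm_d d x \<le> r}"
  proof -
    have "x i \<in> {-r..r}" if "i < d" "norm_d d x \<le> r" for x i
      using component_le_norm_d[of i d x] that by auto
    then show ?thesis
      by (auto simp: cball_d_def in_Rd_iff PiE_iff split: if_splits)
  qed
  moreover have "closed {x. norm_d d x \<le> r}"
    by (intro closed_Collect_le continuous_on_norm_d continuous_intros)
  ultimately show ?thesis
    using B by (simp add: compact_Int_closed)
qed

section \<open>Orthonormal systems under linear constraints\<close>

text \<open>Elimination, by induction on the number of equations: equation \<open>p\<close>
  expresses an unknown \<open>k\<close> through the others, and substituting it turns the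
  coefficients \<open>a\<close> into \<open>b\<close>, with one unknown and one equation
  fewer.\<close>

lemma homogeneous_system_nontrivial:
  fixes a :: "nat \<Rightarrow> 'b \<Rightarrow> 'a::field"
  assumes "finite I" "p < card I"
  shows "\<exists>x. (\<exists>i\<in>I. x i \<noteq> 0) \<and> (\<forall>j<p. (\<Sum>i\<in>I. a j i * x i) = 0)"
  using assms
proof (induction p arbitrary: I a)
  case 0
  then have "I \<noteq> {}" by auto
  then show ?case by (intro exI[of _ "\<lambda>_. 1"]) auto
next
  case (Suc p)
  show ?case
  proof (cases "\<forall>i\<in>I. a p i = 0")
    case True
    obtain x where "\<exists>i\<in>I. x i \<noteq> 0" "\<forall>j<p. (\<Sum>i\<in>I. a j i * x i) = 0"
      using Suc.IH[of I a] Suc.prems by auto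
    with True show ?thesis
      by (intro exI[of _ x]) (auto simp: less_Suc_eq)
  next
    case False
    then obtain k where k: "k \<in> I" "a p k \<noteq> 0" by blast
    define b where "b j i = a j i - a j k / a p k * a p i" for j i
    have "p < card (I - {k})"
      using Suc.prems k by simp
    then obtain x where x: "\<exists>i\<in>I - {k}. x i \<noteq> 0" "\<forall>j<p. (\<Sum>i\<in>I - {k}. b j i * x i) = 0"
      using Suc.IH[of "I - {k}" b] Suc.prems by auto
    define s where "s = (\<Sum>i\<in>I - {k}. a p i * x i)"
    define y where "y = x(k := - s / a p k)"
    have sum_y: "(\<Sum>i\<in>I. a j i * y i) = (\<Sum>i\<in>I - {k}. a j i * x i) - a j k * s / a p k" for j
    proof -
      have "(\<Sum>i\<in>I. a j i * y i) = a j k * y k + (\<Sum>i\<in>I - {k}. a j i * y i)"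
        using k Suc.prems by (simp add: sum.remove)
      also have "(\<Sum>i\<in>I - {k}. a j i * y i) = (\<Sum>i\<in>I - {k}. a j i * x i)"
        by (rule sum.cong) (auto simp: y_def)
      finally show ?thesis by (simp add: y_def)
    qed
    have "(\<Sum>i\<in>I. a j i * y i) = 0" if "j < Suc p" for j
    proof (cases "j = p")
      case True
      then show ?thesis using k by (simp add: sum_y s_def)
    next
      case False
      have "0 = (\<Sum>i\<in>I - {k}. b j i * x i)" using x False that by simp
      also have "\<dots> = (\<Sum>i\<in>I - {k}. a j i * x i) - (\<Sum>i\<in>I - {k}. a j k / a p k * (a p i * x i))"
        by (simp add: b_def algebra_simps sum_subtractf)
      also have "\<dots> = (\<Sum>i\<in>I - {k}. a j i * x i) - a j k / a p k * s"
        unfolding s_def sum_distrib_left ..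
      finally show ?thesis by (simp add: sum_y)
    qed
    moreover have "\<exists>i\<in>I. y i \<noteq> 0" using x(1) by (auto simp: y_def)
    ultimately show ?thesis by blast
  qed
qed

lemma exists_unit_vector_orthogonal:
  assumes "p < d"
  shows "\<exists>v\<in>Rd d. inner_d d v v = 1 \<and> (\<forall>j<p. inner_d d (w j) v = 0)"
proof -
  obtain x where x: "\<exists>i\<in>{..<d}. x i \<noteq> 0" "\<forall>j<p. (\<Sum>i<d. w j i * x i) = 0"
    using homogeneous_system_nontrivial[of "{..<d}" p w] assms by auto
  define y where "y i = (if i < d then x i else 0)" for i
  define v where "v = (\<lambda>i. inverse (norm_d d y) * y i)"
  have y: "y \<in> Rd d" "y \<noteq> (\<lambda>_. 0)"
    using x(1) by (auto simp: in_Rd_iff y_def fun_eq_iff)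
  then have pos: "norm_d d y \<noteq> 0" by (simp add: norm_d_eq_0_iff)
  have "inner_d d v v = (inverse (norm_d d y) * norm_d d y)\<^sup>2"
    unfolding power_mult_distrib norm_d_sq v_def
    by (simp only: inner_d_scale_left inner_d_scale_right power2_eq_square mult.assoc)
  with pos have "inner_d d v v = 1" by simp
  moreover have "inner_d d (w j) v = 0" if "j < p" for j
    using x(2) that by (simp add: v_def inner_d_linear) (simp add: inner_d_def y_def)
  moreover have "v \<in> Rd d" using y by (simp add: v_def in_Rd_iff)
  ultimately show ?thesis by blast
qed

definition orthonormal_d :: "nat \<Rightarrow> nat \<Rightarrow> (nat \<Rightarrow> point) \<Rightarrow> bool" where
  "orthonormal_d d n e \<longleftrightarrow> (\<forall>k<n. e k \<in> Rd d) \<and>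
     (\<forall>k<n. \<forall>l<n. inner_d d (e k) (e l) = (if k = l then 1 else 0))"

lemma orthonormal_d_Suc:
  assumes "orthonormal_d d n e" "v \<in> Rd d" "inner_d d v v = 1" "\<forall>k<n. inner_d d (e k) v = 0"
  shows "orthonormal_d d (Suc n) (e(n := v))"
proof -
  have "\<forall>k<n. inner_d d v (e k) = 0"
    using assms(4) by (simp add: inner_d_commute)
  with assms show ?thesis
    by (auto simp: orthonormal_d_def less_Suc_eq)
qed

text \<open>Vectors already found join the constraints \<open>w\<close>; there are fewer than
  \<open>d\<close> constraints as long as another vector is wanted.\<close>

lemma orthonormal_system_orthogonal:
  assumes "p + n \<le> d"
  shows "\<exists>e. orthonormal_d d n e \<and> (\<forall>k<n. \<forall>j<p. inner_d d (w j) (e k) = 0)"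
  using assms
proof (induction n)
  case 0
  show ?case by (simp add: orthonormal_d_def)
next
  case (Suc n)
  then obtain e where e: "orthonormal_d d n e" "\<forall>k<n. \<forall>j<p. inner_d d (w j) (e k) = 0"
    by auto
  define u where "u j = (if j < p then w j else e (j - p))" for j
  obtain v where v: "v \<in> Rd d" "inner_d d v v = 1" "\<forall>j<p + n. inner_d d (u j) v = 0"
    using exists_unit_vector_orthogonal[of "p + n" d u] Suc.prems by auto
  have "inner_d d (w j) v = 0" if "j < p" for j
    using v(3)[rule_format, of j] that by (simp add: u_def)
  moreover have "inner_d d (e k) v = 0" if "k < n" for k
    using v(3)[rule_format, of "p + k"] that by (simp add: u_def)
  ultimately show ?case
    using e v
    by (intro exI[of _ "e(n := v)"] conjI orthonormal_d_Suc) (auto simp: less_Suc_eq)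
qed

lemma inner_d_orthonormal_combination:
  assumes "orthonormal_d d n e"
  shows "inner_d d (\<lambda>i. \<Sum>k<n. a k * e k i) (\<lambda>i. \<Sum>k<n. b k * e k i) = (\<Sum>k<n. a k * b k)"
proof -
  have "inner_d d (\<lambda>i. \<Sum>k<n. a k * e k i) (\<lambda>i. \<Sum>k<n. b k * e k i)
      = (\<Sum>k<n. \<Sum>l<n. b k * (a l * inner_d d (e l) (e k)))"
    by (subst sum.swap) (simp add: inner_d_linear sum_distrib_left mult_ac)
  also have "\<dots> = (\<Sum>k<n. \<Sum>l<n. if k = l then a k * b k else 0)"
    using assms by (intro sum.cong refl) (auto simp: orthonormal_d_def)
  finally show ?thesis by simp
qed

lemma bessel_inequality:
  assumes "orthonormal_d d n e"
  shows "(\<Sum>k<n. (inner_d d (e k) x)\<^sup>2) \<le> inner_d d x x"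
proof -
  define p where "p = (\<lambda>i. \<Sum>k<n. inner_d d (e k) x * e k i)"
  have "inner_d d p p = (\<Sum>k<n. (inner_d d (e k) x)\<^sup>2)"
    unfolding p_def by (simp add: inner_d_orthonormal_combination[OF assms] power2_eq_square)
  moreover have "inner_d d p x = (\<Sum>k<n. (inner_d d (e k) x)\<^sup>2)"
    by (simp add: p_def inner_d_linear power2_eq_square)
  moreover have "0 \<le> inner_d d (x - p) (x - p)"
    by (simp flip: norm_d_sq)
  ultimately show ?thesis
    by (simp add: inner_d_linear inner_d_commute[of d x p])
qed

section \<open>Flat unit vectors by a choice of signs\<close>

text \<open>Termwise comparison of the power series, by (2 n)! \<ge> 2^n * n!. This is the moment
  bound of Hoeffding for one random sign.\<close>

lemma cosh_le_exp_half_square: "cosh x \<le> exp (x\<^sup>2 / 2)" for x :: real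
proof -
  have "(\<lambda>n. if even n then x ^ n / fact n else 0) sums cosh x"
    using cosh_converges[of x] by (simp add: divide_inverse mult.commute cong: if_cong)
  then have "(\<lambda>n. \<Sum>m\<in>{n * 2..<n * 2 + 2}. if even m then x ^ m / fact m else 0) sums cosh x"
    by (rule sums_group) simp
  moreover have "(\<Sum>m\<in>{n * 2..<n * 2 + 2}. if even m then x ^ m / fact m else 0)
      = x ^ (2 * n) / fact (2 * n)" for n
  proof -
    have "{n * 2..<n * 2 + 2} = {2 * n, Suc (2 * n)}" by auto
    then show ?thesis by simp
  qed
  ultimately have c: "(\<lambda>n. x ^ (2 * n) / fact (2 * n)) sums cosh x" by (simp only:)
  have e: "(\<lambda>n. (x\<^sup>2 / 2) ^ n / fact n) sums exp (x\<^sup>2 / 2)"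
    using exp_converges[of "x\<^sup>2 / 2"] by (simp only: real_scaleR_def divide_inverse_commute)
  have fact_ge: "2 ^ n * fact n \<le> (fact (2 * n) :: real)" for n
  proof (induction n)
    case (Suc n)
    have "(2::real) ^ Suc n * fact (Suc n) = (2 * real n + 2) * (2 ^ n * fact n)" by simp
    also have "\<dots> \<le> (2 * real n + 2) * fact (2 * n)"
      by (intro mult_left_mono Suc.IH) simp
    also have "\<dots> \<le> (2 * real n + 2) * ((2 * real n + 1) * fact (2 * n))"
      by (intro mult_left_mono) (simp_all add: mult_le_cancel_right1)
    also have "\<dots> = fact (2 * Suc n)" by (simp add: algebra_simps)
    finally show ?case .
  qed simp
  have "x ^ (2 * n) / fact (2 * n) \<le> (x\<^sup>2 / 2) ^ n / fact n" for n
  proof -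
    have "(x\<^sup>2 / 2) ^ n / fact n = x ^ (2 * n) / (2 ^ n * fact n)"
      by (simp add: power_divide power_mult)
    moreover have "x ^ (2 * n) / fact (2 * n) \<le> x ^ (2 * n) / (2 ^ n * fact n)"
      by (intro divide_left_mono fact_ge) (simp_all add: power_mult)
    ultimately show ?thesis by simp
  qed
  then show ?thesis by (rule sums_le[OF _ c e])
qed

text \<open>Derandomised Hoeffding bound: choosing the signs one by one, some choice does not exceed the
  average of the exponential potential.\<close>

lemma signs_cosh_potential:
  fixes a :: "'b \<Rightarrow> nat \<Rightarrow> real"
  assumes "\<And>j. j \<in> J \<Longrightarrow> 0 \<le> W j"
  shows "\<exists>s. (\<forall>k. s k = 1 \<or> s k = -1) \<and>
    (\<Sum>j\<in>J. W j * cosh (\<Sum>k<n. s k * a j k)) \<le> (\<Sum>j\<in>J. W j * exp ((\<Sum>k<n. (a j k)\<^sup>2) / 2))"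
  using assms
proof (induction n arbitrary: W)
  case 0
  then show ?case by (intro exI[of _ "\<lambda>_. 1"]) auto
next
  case (Suc n)
  \<comment> \<open>The last coordinate contributes a factor that does not depend on the other
    signs, so it is absorbed into the weights; this is why the induction runs over all
    weights.\<close>
  define W' where "W' j = W j * exp ((a j n)\<^sup>2 / 2)" for j
  obtain s where s: "\<forall>k. s k = 1 \<or> s k = (-1::real)"
    "(\<Sum>j\<in>J. W' j * cosh (\<Sum>k<n. s k * a j k)) \<le> (\<Sum>j\<in>J. W' j * exp ((\<Sum>k<n. (a j k)\<^sup>2) / 2))"
    using Suc.IH[of W'] Suc.prems by (auto simp: W'_def)
  define S where "S j = (\<Sum>k<n. s k * a j k)" for j
  define F where "F \<sigma> = (\<Sum>j\<in>J. W j * cosh (S j + \<sigma> * a j n))" for \<sigma>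
  \<comment> \<open>The sinh terms of the two addition formulas cancel, so one of the two signs does
    at least as well as their mean.\<close>
  have "F 1 + F (-1) = (\<Sum>j\<in>J. 2 * (W j * (cosh (S j) * cosh (a j n))))"
    unfolding F_def sum.distrib[symmetric]
    by (intro sum.cong refl) (simp add: cosh_add cosh_diff algebra_simps)
  also have "\<dots> \<le> (\<Sum>j\<in>J. 2 * (W j * (cosh (S j) * exp ((a j n)\<^sup>2 / 2))))"
    using Suc.prems by (intro sum_mono mult_left_mono cosh_le_exp_half_square) auto
  also have "\<dots> = 2 * (\<Sum>j\<in>J. W' j * cosh (S j))"
    by (simp add: W'_def sum_distrib_left mult_ac)
  also have "\<dots> \<le> 2 * (\<Sum>j\<in>J. W' j * exp ((\<Sum>k<n. (a j k)\<^sup>2) / 2))"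
    using s(2) by (simp add: S_def)
  also have "\<dots> = 2 * (\<Sum>j\<in>J. W j * exp ((\<Sum>k<Suc n. (a j k)\<^sup>2) / 2))"
    by (simp add: W'_def add_divide_distrib exp_add mult_ac)
  finally have "F 1 + F (-1) \<le> 2 * (\<Sum>j\<in>J. W j * exp ((\<Sum>k<Suc n. (a j k)\<^sup>2) / 2))" .
  then obtain \<sigma> where \<sigma>: "\<sigma> = 1 \<or> \<sigma> = (-1::real)"
    "F \<sigma> \<le> (\<Sum>j\<in>J. W j * exp ((\<Sum>k<Suc n. (a j k)\<^sup>2) / 2))"
    by (smt (verit))
  have "(\<Sum>k<n. (s(n := \<sigma>)) k * a j k) = S j" for j
    unfolding S_def by (rule sum.cong) auto
  then have "F \<sigma> = (\<Sum>j\<in>J. W j * cosh (\<Sum>k<Suc n. (s(n := \<sigma>)) k * a j k))"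
    unfolding F_def by simp
  with \<sigma> s(1) show ?case
    by (intro exI[of _ "s(n := \<sigma>)"]) auto
qed

text \<open>Each single term of the potential is bounded by the whole: cosh (l * S) \<le> card J *
  exp (l^2 * r^2 / 2) for every signed sum S. Taking logarithms bounds |S|.\<close>

lemma signs_small_sums:
  fixes a :: "'b \<Rightarrow> nat \<Rightarrow> real"
  assumes J: "finite J" "2 * real (card J) \<le> B" and B: "1 < B" and r: "0 < r"
    and a: "\<And>j. j \<in> J \<Longrightarrow> (\<Sum>k<n. (a j k)\<^sup>2) \<le> r\<^sup>2"
  shows "\<exists>s. (\<forall>k. s k = 1 \<or> s k = -1) \<and> (\<forall>j\<in>J. \<bar>\<Sum>k<n. s k * a j k\<bar> \<le> r * sqrt (2 * ln B))"
proof -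
  \<comment> \<open>With this rate exp (l^2 * r^2 / 2) = B, so exp (l * |S|) \<le> B^2 and |S| \<le>
    2 * ln B / l = r * sqrt (2 * ln B).\<close>
  define l where "l = sqrt (2 * ln B) / r"
  have l: "0 < l" "(l * r)\<^sup>2 = 2 * ln B"
    using B r by (simp_all add: l_def)
  obtain s where s: "\<forall>k. s k = 1 \<or> s k = (-1::real)"
    "(\<Sum>j\<in>J. 1 * cosh (\<Sum>k<n. s k * (l * a j k))) \<le> (\<Sum>j\<in>J. 1 * exp ((\<Sum>k<n. (l * a j k)\<^sup>2) / 2))"
    using signs_cosh_potential[where J = J and W = "\<lambda>_. 1" and n = n and a = "\<lambda>j k. l * a j k"] by auto
  have "\<bar>\<Sum>k<n. s k * a j k\<bar> \<le> r * sqrt (2 * ln B)" if j: "j \<in> J" for j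
  proof -
    let ?S = "\<lambda>j. \<Sum>k<n. s k * a j k"
    have lS: "(\<Sum>k<n. s k * (l * a j k)) = l * ?S j" for j
      by (simp add: sum_distrib_left mult_ac)
    have "exp (l * \<bar>?S j\<bar>) / 2 \<le> cosh (l * ?S j)"
      by (cases "?S j \<ge> 0") (simp_all add: cosh_def)
    also have "\<dots> \<le> (\<Sum>j\<in>J. cosh (l * ?S j))"
      using J j by (intro member_le_sum) (simp_all add: cosh_real_nonneg)
    also have "\<dots> \<le> (\<Sum>j\<in>J. exp ((\<Sum>k<n. (l * a j k)\<^sup>2) / 2))"
      using s(2) by (simp add: lS)
    also have "\<dots> \<le> (\<Sum>j\<in>J. B)"
    proof (rule sum_mono)
      fix j assume "j \<in> J"
      have "(\<Sum>k<n. (l * a j k)\<^sup>2) / 2 = l\<^sup>2 * (\<Sum>k<n. (a j k)\<^sup>2) / 2"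
        by (simp add: power_mult_distrib sum_distrib_left)
      also have "\<dots> \<le> l\<^sup>2 * r\<^sup>2 / 2"
        using a[OF \<open>j \<in> J\<close>] by (intro divide_right_mono mult_left_mono) auto
      also have "\<dots> = ln B" using l by (simp add: power_mult_distrib)
      finally show "exp ((\<Sum>k<n. (l * a j k)\<^sup>2) / 2) \<le> B"
        using B by (metis exp_le_cancel_iff exp_ln less_trans zero_less_one)
    qed
    also have "\<dots> \<le> B / 2 * B"
      using J(2) B by (simp add: mult_right_mono)
    finally have "exp (l * \<bar>?S j\<bar>) \<le> B * B" by simp
    also have "\<dots> = exp (2 * ln B)"
      using B by (simp only: mult_2 exp_add exp_ln)
    finally have "l * \<bar>?S j\<bar> \<le> l * (r * sqrt (2 * ln B))"
      using l r by (simp add: l_def)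
    then show ?thesis using l by simp
  qed
  with s(1) show ?thesis by blast
qed

text \<open>Orthogonality to the \<open>w i\<close> is exact because \<open>v\<close> is built from
  \<open>n\<close> orthonormal vectors orthogonal to all of them. Flatness comes from the signs: the
  coefficients of \<open>x j\<close> in this system have square sum at most r^2 by Bessel, and the
  weights 1 / sqrt n that normalise \<open>v\<close> gain the factor 1 / sqrt n. Exact constraints
  cost dimension, flat ones only the logarithm of their number.\<close>

lemma unit_vector_orthogonal_and_flat:
  assumes n: "p + n \<le> d" "0 < n"
    and J: "finite J" "2 * real (card J) \<le> B" and B: "1 < B" and r: "0 < r"
    and x: "\<And>j. j \<in> J \<Longrightarrow> norm_d d (x j) \<le> r"
  shows "\<exists>v\<in>Rd d. inner_d d v v = 1 \<and> (\<forall>i<p. inner_d d (w i) v = 0) \<and>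
    (\<forall>j\<in>J. \<bar>inner_d d v (x j)\<bar> \<le> r * sqrt (2 * ln B / real n))"
proof -
  obtain e where e: "orthonormal_d d n e" "\<forall>k<n. \<forall>j<p. inner_d d (w j) (e k) = 0"
    using orthonormal_system_orthogonal[OF n(1)] by blast
  have "(\<Sum>k<n. (inner_d d (e k) (x j))\<^sup>2) \<le> r\<^sup>2" if "j \<in> J" for j
    using bessel_inequality[OF e(1), of "x j"] x[OF that] r by (simp add: norm_d_le_iff)
  then obtain s where s: "\<forall>k. s k = 1 \<or> s k = (-1::real)"
    "\<forall>j\<in>J. \<bar>\<Sum>k<n. s k * inner_d d (e k) (x j)\<bar> \<le> r * sqrt (2 * ln B)"
    using signs_small_sums[OF J B r, where n = n and a = "\<lambda>j k. inner_d d (e k) (x j)"] by blast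
  define c where "c = 1 / sqrt (real n)"
  define v where "v = (\<lambda>i. \<Sum>k<n. (c * s k) * e k i)"
  have "inner_d d v v = (\<Sum>k<n. (c * s k) * (c * s k))"
    unfolding v_def by (rule inner_d_orthonormal_combination[OF e(1)])
  also have "\<dots> = (\<Sum>k<n. 1 / real n)"
  proof (rule sum.cong)
    fix k show "c * s k * (c * s k) = 1 / real n"
      using s(1)[rule_format, of k] n by (auto simp: c_def)
  qed simp
  finally have "inner_d d v v = 1" using n by simp
  moreover have "v \<in> Rd d"
    using e(1) by (auto simp: v_def in_Rd_iff orthonormal_d_def)
  moreover have "inner_d d (w i) v = 0" if "i < p" for i
    using e(2) that by (simp add: v_def inner_d_linear)
  moreover have "\<bar>inner_d d v (x j)\<bar> \<le> r * sqrt (2 * ln B / real n)" if "j \<in> J" for j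
  proof -
    have "inner_d d v (x j) = c * (\<Sum>k<n. s k * inner_d d (e k) (x j))"
      by (simp add: v_def inner_d_linear sum_distrib_left mult_ac)
    also have "\<bar>\<dots>\<bar> \<le> c * (r * sqrt (2 * ln B))"
      using s(2) that by (simp add: abs_mult c_def divide_right_mono)
    finally show ?thesis by (simp add: c_def real_sqrt_divide)
  qed
  ultimately show ?thesis by blast
qed
subsection \<open>Smooth strongly convex functions\<close>

lemma tendsto_norm_d_diff: "((\<lambda>y. norm_d d (y - x)) \<longlongrightarrow> 0) (at x within S)"
proof -
  have "continuous_on UNIV (\<lambda>y. norm_d d (y - x))"
    unfolding norm_d_def L2_set_def minus_apply
    by (intro continuous_intros continuous_on_subset[OF continuous_on_product_coordinates]) simp
  then have "((\<lambda>y. norm_d d (y - x)) \<longlongrightarrow> norm_d d (x - x)) (at x within UNIV)"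
    by (simp add: continuous_on_def)
  moreover have "norm_d d (x - x) = 0"
    by (simp add: norm_d_def L2_set_def)
  ultimately show ?thesis
    by (metis tendsto_within_subset subset_UNIV)
qed

text \<open>Convexity at the far endpoint replaces the integral form of the descent lemma, at the price of
  the constant \<open>\<beta>\<close> in place of \<open>\<beta> / 2\<close>.\<close>

lemma descent_inequality:
  assumes convex: "f x \<ge> f y + inner_d d (G y) (x - y)"
    and lipschitz: "norm_d d (G x - G y) \<le> \<beta> * norm_d d (x - y)"
  shows "f y \<le> f x + inner_d d (G x) (y - x) + \<beta> * (norm_d d (y - x))\<^sup>2"
proof -
  have "inner_d d (G y - G x) (y - x) \<le> norm_d d (G y - G x) * norm_d d (y - x)"
    by (rule inner_d_le)
  also have "\<dots> \<le> \<beta> * norm_d d (y - x) * norm_d d (y - x)"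
    using lipschitz by (intro mult_right_mono) (simp_all add: norm_d_diff_commute)
  finally show ?thesis
    using convex by (simp add: inner_d_linear power2_eq_square)
qed

text \<open>Two inequalities give all the analysis: convexity from below and descent from above
  enclose \<open>f\<close> between its tangent and a quadratic, hence gradient and continuity. A
  minimum exists on the compact ball, and \<open>outside\<close> makes it global. Both conclusions
  are drawn together because they speak of the same minimizer.\<close>

lemma objective_classI:
  assumes G: "\<And>x. x \<in> Rd d \<Longrightarrow> G x \<in> Rd d"
    and convex: "\<And>x y. x \<in> Rd d \<Longrightarrow> y \<in> Rd d \<Longrightarrow>
      f y \<ge> f x + inner_d d (G x) (y - x) + \<mu> / 2 * (norm_d d (y - x))\<^sup>2"
    and lipschitz: "\<And>x y. x \<in> Rd d \<Longrightarrow> y \<in> Rd d \<Longrightarrow> norm_d d (G x - G y) \<le> \<beta> * norm_d d (x - y)"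
    and \<mu>: "0 < \<mu>"
    and x0: "x0 \<in> cball_d d (R / 2)" and outside: "\<And>x. x \<in> Rd d - cball_d d (R / 2) \<Longrightarrow> f x0 < f x"
  shows "f \<in> objective_class d R \<mu> \<beta>"
    and "x \<in> Rd d \<Longrightarrow> f (arg_min_on f (Rd d)) \<le> f x"
proof -
  have convex0: "f x + inner_d d (G x) (y - x) \<le> f y" if "x \<in> Rd d" "y \<in> Rd d" for x y
    using convex[OF that] \<mu> by (smt (verit) mult_nonneg_nonneg zero_le_power2 divide_nonneg_pos)
  have descent: "f y \<le> f x + inner_d d (G x) (y - x) + \<beta> * (norm_d d (y - x))\<^sup>2"
    if "x \<in> Rd d" "y \<in> Rd d" for x y
    using descent_inequality convex0 lipschitz that by blast
  have grad: "has_gradient d f (G x) x" if x: "x \<in> Rd d" for x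
    unfolding has_gradient_def
  proof (intro conjI G x, rule tendsto_0_le[where K = "\<bar>\<beta>\<bar>", OF tendsto_norm_d_diff])
    show "\<forall>\<^sub>F y in at x within Rd d. norm ((f y - f x - inner_d d (G x) (y - x)) / norm_d d (y - x))
        \<le> norm (norm_d d (y - x)) * \<bar>\<beta>\<bar>"
      unfolding eventually_at_filter
    proof (intro always_eventually allI impI)
      fix y assume "y \<in> Rd d"
      have "\<beta> * (norm_d d (y - x))\<^sup>2 \<le> \<bar>\<beta>\<bar> * (norm_d d (y - x))\<^sup>2"
        by (intro mult_right_mono) auto
      then have "\<bar>f y - f x - inner_d d (G x) (y - x)\<bar> \<le> \<bar>\<beta>\<bar> * (norm_d d (y - x))\<^sup>2"
        using convex0[OF x \<open>y \<in> Rd d\<close>] descent[OF x \<open>y \<in> Rd d\<close>] by linarith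
      then show "norm ((f y - f x - inner_d d (G x) (y - x)) / norm_d d (y - x))
          \<le> norm (norm_d d (y - x)) * \<bar>\<beta>\<bar>"
        by (cases "norm_d d (y - x) = 0")
          (simp_all add: divide_le_eq power2_eq_square mult_ac less_le)
    qed
  qed
  have contG: "continuous_on (Rd d) G"
  proof (intro continuous_on_coordinatewise_then_product)
    fix i
    show "continuous_on (Rd d) (\<lambda>x. G x i)"
    proof (cases "i < d")
      case True
      show ?thesis
        unfolding continuous_on_def
      proof
        fix x assume x: "x \<in> Rd d"
        have "((\<lambda>y. G y i - G x i) \<longlongrightarrow> 0) (at x within Rd d)"
        proof (rule tendsto_0_le[where K = "\<bar>\<beta>\<bar>", OF tendsto_norm_d_diff])
          show "\<forall>\<^sub>F y in at x within Rd d. norm (G y i - G x i) \<le> norm (norm_d d (y - x)) * \<bar>\<beta>\<bar>"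
            unfolding eventually_at_filter
          proof (intro always_eventually allI impI)
            fix y assume y: "y \<in> Rd d"
            have "\<bar>G y i - G x i\<bar> \<le> norm_d d (G y - G x)"
              using component_le_norm_d[OF True, of "G y - G x"] by simp
            also have "\<dots> \<le> \<beta> * norm_d d (y - x)" by (rule lipschitz[OF y x])
            also have "\<dots> \<le> \<bar>\<beta>\<bar> * norm_d d (y - x)" by (intro mult_right_mono) auto
            finally show "norm (G y i - G x i) \<le> norm (norm_d d (y - x)) * \<bar>\<beta>\<bar>"
              by (simp add: mult.commute)
          qed
        qed
        then show "((\<lambda>y. G y i) \<longlongrightarrow> G x i) (at x within Rd d)"
          by (simp add: LIM_zero_iff)
      qed
    next
      case False
      then have "G x i = 0" if "x \<in> Rd d" for x
        using G[OF that] by (simp add: in_Rd_iff)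
      then show ?thesis by (simp cong: continuous_on_cong)
    qed
  qed
  have contf: "continuous_on (Rd d) f"
    unfolding continuous_on_def
  proof
    fix x assume x: "x \<in> Rd d"
    let ?b = "\<lambda>y. (norm_d d (G x) + \<bar>\<beta>\<bar> * norm_d d (y - x)) * norm_d d (y - x)"
    have "(?b \<longlongrightarrow> (norm_d d (G x) + \<bar>\<beta>\<bar> * 0) * 0) (at x within Rd d)"
      by (intro tendsto_intros tendsto_norm_d_diff)
    then have "(?b \<longlongrightarrow> 0) (at x within Rd d)" by simp
    then have "((\<lambda>y. f y - f x) \<longlongrightarrow> 0) (at x within Rd d)"
    proof (rule tendsto_0_le[where K = 1])
      show "\<forall>\<^sub>F y in at x within Rd d. norm (f y - f x) \<le> norm (?b y) * 1"
        unfolding eventually_at_filter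
      proof (intro always_eventually allI impI)
        fix y assume y: "y \<in> Rd d"
        have "\<beta> * (norm_d d (y - x))\<^sup>2 \<le> \<bar>\<beta>\<bar> * (norm_d d (y - x))\<^sup>2"
          by (intro mult_right_mono) auto
        then have "\<bar>f y - f x\<bar> \<le> norm_d d (G x) * norm_d d (y - x) + \<bar>\<beta>\<bar> * (norm_d d (y - x))\<^sup>2"
          using convex0[OF x y] descent[OF x y] abs_inner_d_le[of d "G x" "y - x"]
            mult_nonneg_nonneg[of "\<bar>\<beta>\<bar>" "(norm_d d (y - x))\<^sup>2"] by (simp add: abs_if split: if_splits)
        also have "\<dots> = ?b y" by (simp add: power2_eq_square algebra_simps)
        finally show "norm (f y - f x) \<le> norm (?b y) * 1" by simp
      qed
    qed
    then show "(f \<longlongrightarrow> f x) (at x within Rd d)"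
      by (simp add: LIM_zero_iff)
  qed
  have "continuous_on (cball_d d (R / 2)) f"
    by (rule continuous_on_subset[OF contf]) (auto simp: cball_d_def)
  then obtain z where z: "z \<in> cball_d d (R / 2)" "\<And>x. x \<in> cball_d d (R / 2) \<Longrightarrow> f z \<le> f x"
    using continuous_attains_inf[OF compact_cball_d, of d "R / 2" f] x0 by blast
  have z_Rd: "z \<in> Rd d" using z(1) by (simp add: cball_d_def)
  have z_min: "f z \<le> f x" if "x \<in> Rd d" for x
    using z(2)[of x] z(2)[OF x0] outside[of x] that by force
  then have z_arg: "is_arg_min f (\<lambda>x. x \<in> Rd d) z"
    using z_Rd by (simp add: is_arg_min_linorder)
  have unique: "x = z" if x: "is_arg_min f (\<lambda>x. x \<in> Rd d) x" for x
  proof -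
    have x_Rd: "x \<in> Rd d" using x by (simp add: is_arg_min_def)
    have "f x = f z" using x z_min[OF x_Rd] z_Rd by (force simp: is_arg_min_linorder)
    \<comment> \<open>Strong convexity is applied from the midpoint towards both minimizers: the two
      gradient terms cancel in the sum, and the quadratic terms must vanish.\<close>
    define m where "m = (\<lambda>i. (x i + z i) / 2)"
    have m: "m \<in> Rd d" using x_Rd z_Rd by (simp add: m_def in_Rd_iff)
    have "x - m = (\<lambda>i. (1 / 2) * (x - z) i)" "z - m = (\<lambda>i. - (1 / 2) * (x - z) i)"
      by (auto simp: m_def fun_eq_iff field_simps)
    then have n: "norm_d d (x - m) = norm_d d (x - z) / 2" "norm_d d (z - m) = norm_d d (x - z) / 2"
      and i: "inner_d d (G m) (x - m) + inner_d d (G m) (z - m) = 0"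
      by (simp_all only: norm_d_scale inner_d_scale_right)
    have "f m + inner_d d (G m) (x - m) + \<mu> / 2 * (norm_d d (x - z) / 2)\<^sup>2 \<le> f z"
      using convex[OF m x_Rd] \<open>f x = f z\<close> n by simp
    moreover have "f m + inner_d d (G m) (z - m) + \<mu> / 2 * (norm_d d (x - z) / 2)\<^sup>2 \<le> f z"
      using convex[OF m z_Rd] n by simp
    ultimately have "\<mu> / 2 * (norm_d d (x - z) / 2)\<^sup>2 \<le> 0"
      using z_min[OF m] i by linarith
    then have "norm_d d (x - z) = 0"
      using \<mu> by (simp add: mult_le_0_iff)
    moreover have "x - z \<in> Rd d" using x_Rd z_Rd by (simp add: in_Rd_iff)
    ultimately have "x - z = (\<lambda>_. 0)"
      by (simp add: norm_d_eq_0_iff)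
    then show "x = z" by (simp add: fun_eq_iff)
  qed
  have arg: "arg_min_on f (Rd d) = z"
    unfolding arg_min_on_def arg_min_def by (rule some_equality[where P = "is_arg_min f (\<lambda>x. x \<in> Rd d)", OF z_arg unique])
  show "f \<in> objective_class d R \<mu> \<beta>"
    unfolding objective_class_def
    using grad contG convex lipschitz z_arg unique arg z(1) by blast
  show "x \<in> Rd d \<Longrightarrow> f (arg_min_on f (Rd d)) \<le> f x"
    using arg z_min by simp
qed

text \<open>\<open>(shrink \<tau>)\<^sup>2 / 2\<close> is half the squared distance to \<open>[-\<tau>, \<tau>]\<close>, and \<open>shrink \<tau>\<close> is its derivative.\<close>

definition shrink :: "real \<Rightarrow> real \<Rightarrow> real" where
  "shrink \<tau> t = t - max (- \<tau>) (min \<tau> t)"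

lemma shrink_eq_0: "\<bar>t\<bar> \<le> \<tau> \<Longrightarrow> shrink \<tau> t = 0"
  by (auto simp: shrink_def)

lemma shrink_lipschitz: "0 \<le> \<tau> \<Longrightarrow> \<bar>shrink \<tau> a - shrink \<tau> b\<bar> \<le> \<bar>a - b\<bar>"
  by (auto simp: shrink_def max_def min_def)

text \<open>The clipped value \<open>?c a\<close> is the point of the interval nearest to
  \<open>a\<close>, and \<open>shrink \<tau> a\<close> is an outward normal there; so its product
  with a move to another point of the interval is not positive. What remains is the convexity of the
  square.\<close>

lemma shrink_convex:
  assumes "0 \<le> \<tau>"
  shows "(shrink \<tau> a)\<^sup>2 / 2 + shrink \<tau> a * (b - a) \<le> (shrink \<tau> b)\<^sup>2 / 2"
proof -
  let ?c = "\<lambda>t. max (- \<tau>) (min \<tau> t)"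
  have "shrink \<tau> a * (?c b - ?c a) \<le> 0"
    using assms by (auto simp: shrink_def mult_le_0_iff)
  moreover have "0 \<le> (shrink \<tau> b - shrink \<tau> a)\<^sup>2" by simp
  then have "shrink \<tau> a * (shrink \<tau> b - shrink \<tau> a) \<le> (shrink \<tau> b)\<^sup>2 / 2 - (shrink \<tau> a)\<^sup>2 / 2"
    by (simp add: power2_eq_square algebra_simps)
  moreover have "shrink \<tau> a * (b - a)
      = shrink \<tau> a * (shrink \<tau> b - shrink \<tau> a) + shrink \<tau> a * (?c b - ?c a)"
    by (simp add: shrink_def algebra_simps)
  ultimately show ?thesis by linarith
qed

text \<open>The tangent of u^2 / 2 at u = a, together with |shrink \<tau> t| \<ge> t - \<tau>. A
  bound that is linear in \<open>t\<close> can be summed along the chain, where the differences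
  telescope.\<close>

lemma shrink_square_ge:
  assumes "0 \<le> a" "0 \<le> \<tau>"
  shows "a * (t - \<tau>) - a\<^sup>2 / 2 \<le> (shrink \<tau> t)\<^sup>2 / 2"
proof -
  have "a * (t - \<tau>) \<le> a * \<bar>shrink \<tau> t\<bar>"
    using assms by (intro mult_left_mono) (auto simp: shrink_def)
  moreover have "0 \<le> (\<bar>shrink \<tau> t\<bar> - a)\<^sup>2" by simp
  then have "2 * (a * \<bar>shrink \<tau> t\<bar>) \<le> \<bar>shrink \<tau> t\<bar>\<^sup>2 + a\<^sup>2"
    by (simp add: power2_eq_square algebra_simps)
  ultimately show ?thesis by simp
qed

section \<open>Sums of ridge functions\<close>

text \<open>This form hides the chain structure: membership in the class depends on \<open>w\<close>
  only through a frame bound and on a common zero of the affine forms.\<close>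

definition ridge_sum ::
  "nat \<Rightarrow> nat \<Rightarrow> real \<Rightarrow> real \<Rightarrow> real \<Rightarrow> (nat \<Rightarrow> real) \<Rightarrow> (nat \<Rightarrow> point) \<Rightarrow> point \<Rightarrow> real" where
  "ridge_sum d n \<alpha> \<tau> \<mu> c w x =
     \<alpha> * (\<Sum>i<n. (shrink \<tau> (c i + inner_d d (w i) x))\<^sup>2 / 2) + \<mu> / 2 * (norm_d d x)\<^sup>2"

text \<open>Synthesis from coefficients is the adjoint of analysis by the \<open>w i\<close>, so it
  inherits the norm bound 2.\<close>

lemma frame_synthesis_norm_le:
  assumes frame: "\<And>x. (\<Sum>i<n. (inner_d d (w i) x)\<^sup>2) \<le> 4 * (norm_d d x)\<^sup>2"
  shows "norm_d d (\<lambda>j. \<Sum>i<n. u i * w i j) \<le> 2 * L2_set u {..<n}"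
proof -
  define p where "p = (\<lambda>j. \<Sum>i<n. u i * w i j)"
  have "L2_set (\<lambda>i. inner_d d (w i) p) {..<n} \<le> sqrt (4 * (norm_d d p)\<^sup>2)"
    unfolding L2_set_def by (intro real_sqrt_le_mono frame)
  then have L: "L2_set (\<lambda>i. inner_d d (w i) p) {..<n} \<le> 2 * norm_d d p"
    by (simp add: real_sqrt_mult)
  have "(norm_d d p)\<^sup>2 = inner_d d (\<lambda>j. \<Sum>i<n. u i * w i j) p"
    by (simp only: norm_d_sq p_def)
  also have "\<dots> = (\<Sum>i<n. u i * inner_d d (w i) p)"
    by (simp add: inner_d_sum_left inner_d_scale_left)
  also have "\<dots> \<le> (\<Sum>i<n. \<bar>u i\<bar> * \<bar>inner_d d (w i) p\<bar>)"
    by (intro sum_mono) (metis abs_ge_self abs_mult)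
  also have "\<dots> \<le> L2_set u {..<n} * L2_set (\<lambda>i. inner_d d (w i) p) {..<n}"
    by (rule L2_set_mult_ineq)
  also have "\<dots> \<le> L2_set u {..<n} * (2 * norm_d d p)"
    by (intro mult_left_mono L L2_set_nonneg)
  finally have "norm_d d p * norm_d d p \<le> (2 * L2_set u {..<n}) * norm_d d p"
    by (simp add: power2_eq_square mult_ac)
  then have "norm_d d p \<le> 2 * L2_set u {..<n}"
    by (cases "norm_d d p = 0") (simp_all add: L2_set_nonneg mult_le_cancel_right less_le)
  then show ?thesis by (simp only: p_def)
qed

text \<open>At \<open>x0\<close> only the quadratic term is left, at most \<mu> * R^2 / 8; outside
  the ball of radius R / 2 the quadratic term alone exceeds this, so the minimizer cannot lie there.
  In the smoothness constant, 4 is the product of the bounds 2 for analysis and 2 for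
  synthesis.\<close>

lemma ridge_sum_objective:
  assumes w: "\<And>i. i < n \<Longrightarrow> w i \<in> Rd d"
    and frame: "\<And>x. (\<Sum>i<n. (inner_d d (w i) x)\<^sup>2) \<le> 4 * (norm_d d x)\<^sup>2"
    and params: "0 \<le> \<alpha>" "0 \<le> \<tau>" "0 < \<mu>" "4 * \<alpha> + \<mu> \<le> \<beta>" "0 < R"
    and x0: "x0 \<in> cball_d d (R / 2)" "\<And>i. i < n \<Longrightarrow> c i + inner_d d (w i) x0 = 0"
  defines "f \<equiv> ridge_sum d n \<alpha> \<tau> \<mu> c w"
  shows "f \<in> objective_class d R \<mu> \<beta>" "f (arg_min_on f (Rd d)) \<le> \<mu> * R\<^sup>2 / 8"
proof -
  define t where "t i x = c i + inner_d d (w i) x" for i x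
  define P where "P u = (\<lambda>j. \<Sum>i<n. u i * w i j)" for u :: "nat \<Rightarrow> real"
  \<comment> \<open>The gradient: derivatives of the ridges, synthesised by \<open>P\<close>, plus
    that of the quadratic term.\<close>
  define G where "G x = (\<lambda>j. \<alpha> * P (\<lambda>i. shrink \<tau> (t i x)) j + \<mu> * x j)" for x
  have f: "f x = \<alpha> * (\<Sum>i<n. (shrink \<tau> (t i x))\<^sup>2 / 2) + \<mu> / 2 * (norm_d d x)\<^sup>2" for x
    by (simp add: f_def ridge_sum_def t_def)
  have G_Rd: "G x \<in> Rd d" if "x \<in> Rd d" for x
    using that w by (simp add: G_def P_def in_Rd_iff)
  have inner_P: "inner_d d (P u) x = (\<Sum>i<n. u i * inner_d d (w i) x)" for u x
    by (simp add: P_def inner_d_sum_left inner_d_scale_left)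
  have convex: "f x + inner_d d (G x) (y - x) + \<mu> / 2 * (norm_d d (y - x))\<^sup>2 \<le> f y" for x y
  proof -
    have "(\<Sum>i<n. (shrink \<tau> (t i x))\<^sup>2 / 2 + shrink \<tau> (t i x) * inner_d d (w i) (y - x))
        \<le> (\<Sum>i<n. (shrink \<tau> (t i y))\<^sup>2 / 2)"
    proof (rule sum_mono)
      fix i
      have "inner_d d (w i) (y - x) = t i y - t i x"
        by (simp add: t_def inner_d_diff_right)
      then show "(shrink \<tau> (t i x))\<^sup>2 / 2 + shrink \<tau> (t i x) * inner_d d (w i) (y - x)
          \<le> (shrink \<tau> (t i y))\<^sup>2 / 2"
        using shrink_convex[OF params(2)] by simp
    qed
    then have "\<alpha> * (\<Sum>i<n. (shrink \<tau> (t i x))\<^sup>2 / 2 + shrink \<tau> (t i x) * inner_d d (w i) (y - x))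
        \<le> \<alpha> * (\<Sum>i<n. (shrink \<tau> (t i y))\<^sup>2 / 2)"
      using params(1) by (rule mult_left_mono)
    moreover have "inner_d d (G x) (y - x)
        = \<alpha> * (\<Sum>i<n. shrink \<tau> (t i x) * inner_d d (w i) (y - x)) + \<mu> * inner_d d x (y - x)"
      by (simp only: G_def inner_d_add_left inner_d_scale_left inner_P)
    moreover have "(norm_d d y)\<^sup>2 = (norm_d d x)\<^sup>2 + 2 * inner_d d x (y - x) + (norm_d d (y - x))\<^sup>2"
      by (simp add: norm_d_sq inner_d_diff_left inner_d_diff_right inner_d_commute[of d y x])
    ultimately show ?thesis
      by (simp add: f sum.distrib algebra_simps)
  qed
  have lipschitz: "norm_d d (G x - G y) \<le> \<beta> * norm_d d (x - y)" for x y
  proof -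
    define u where "u i = shrink \<tau> (t i x) - shrink \<tau> (t i y)" for i
    have "L2_set u {..<n} \<le> L2_set (\<lambda>i. inner_d d (w i) (x - y)) {..<n}"
      unfolding L2_set_def
    proof (intro real_sqrt_le_mono sum_mono)
      fix i
      have "inner_d d (w i) (x - y) = t i x - t i y"
        by (simp add: t_def inner_d_diff_right)
      then show "(u i)\<^sup>2 \<le> (inner_d d (w i) (x - y))\<^sup>2"
        using shrink_lipschitz[OF params(2)] by (simp add: u_def flip: abs_le_square_iff)
    qed
    also have "\<dots> \<le> sqrt (4 * (norm_d d (x - y))\<^sup>2)"
      unfolding L2_set_def by (intro real_sqrt_le_mono frame)
    finally have L: "L2_set u {..<n} \<le> 2 * norm_d d (x - y)"
      by (simp add: real_sqrt_mult)
    have "G x - G y = (\<lambda>j. \<alpha> * P u j + \<mu> * (x - y) j)"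
      by (simp add: fun_eq_iff G_def P_def u_def algebra_simps sum_subtractf)
    then have "norm_d d (G x - G y) \<le> norm_d d (\<lambda>j. \<alpha> * P u j) + norm_d d (\<lambda>j. \<mu> * (x - y) j)"
      by (simp only: norm_d_triangle)
    also have "\<dots> = \<alpha> * norm_d d (P u) + \<mu> * norm_d d (x - y)"
      using params by (simp only: norm_d_scale)
    also have "\<dots> \<le> \<alpha> * (2 * (2 * norm_d d (x - y))) + \<mu> * norm_d d (x - y)"
      using frame_synthesis_norm_le[OF frame, of u] L params
      by (intro add_right_mono mult_left_mono) (simp_all add: P_def)
    also have "\<dots> = (4 * \<alpha> + \<mu>) * norm_d d (x - y)" by (simp add: algebra_simps)
    also have "\<dots> \<le> \<beta> * norm_d d (x - y)"
      using params by (intro mult_right_mono) auto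
    finally show ?thesis .
  qed
  have f_x0: "f x0 = \<mu> / 2 * (norm_d d x0)\<^sup>2"
    using x0(2) params by (simp add: f t_def shrink_eq_0)
  have "(norm_d d x0)\<^sup>2 \<le> (R / 2)\<^sup>2"
    using x0(1) by (intro power_mono) (auto simp: cball_d_def)
  then have f_x0_le: "f x0 \<le> \<mu> / 2 * (R / 2)\<^sup>2"
    using params by (simp only: f_x0) (intro mult_left_mono, auto)
  have outside: "f x0 < f x" if x: "x \<in> Rd d - cball_d d (R / 2)" for x
  proof -
    have "(R / 2)\<^sup>2 < (norm_d d x)\<^sup>2"
      using x params by (intro power_strict_mono) (auto simp: cball_d_def)
    then have "\<mu> / 2 * (R / 2)\<^sup>2 < \<mu> / 2 * (norm_d d x)\<^sup>2"
      using params by (intro mult_strict_left_mono) auto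
    also have "\<dots> \<le> f x"
      using params by (simp add: f sum_nonneg)
    finally show ?thesis using f_x0_le by simp
  qed
  note * = objective_classI[of d G f \<mu> \<beta> x0 R, OF G_Rd convex lipschitz params(3) x0(1) outside]
  show "f \<in> objective_class d R \<mu> \<beta>" by (rule *(1))
  have "f (arg_min_on f (Rd d)) \<le> f x0"
    using x0(1) by (intro *(2)) (auto simp: cball_d_def)
  then show "f (arg_min_on f (Rd d)) \<le> \<mu> * R\<^sup>2 / 8"
    using f_x0_le by (simp add: power2_eq_square)
qed
subsection \<open>The resisting oracle\<close>

text \<open>Position 0 holds the constant \<open>s\<close>, which shifts the directions by one.
  Directions that are still hidden read as 0.\<close>

definition chain_coord :: "nat \<Rightarrow> real \<Rightarrow> (nat \<Rightarrow> point) \<Rightarrow> nat \<Rightarrow> point \<Rightarrow> nat \<Rightarrow> real" where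
  "chain_coord d s v k x i = (if i = 0 then s else if i \<le> k then inner_d d (v (i - 1)) x else 0)"

text \<open>The hard instance uses \<open>k = N\<close>; for \<open>k < N\<close> this is what the algorithm sees while
  \<open>v k, \<dots>, v (N - 1)\<close> are still hidden.\<close>

definition chain ::
  "nat \<Rightarrow> nat \<Rightarrow> real \<Rightarrow> real \<Rightarrow> real \<Rightarrow> real \<Rightarrow> (nat \<Rightarrow> point) \<Rightarrow> nat \<Rightarrow> point \<Rightarrow> real" where
  "chain d N \<alpha> \<tau> \<mu> s v k x =
     \<alpha> * (\<Sum>i<N. (shrink \<tau> (chain_coord d s v k x i - chain_coord d s v k x (Suc i)))\<^sup>2 / 2)
     + \<mu> / 2 * (norm_d d x)\<^sup>2"

lemma chain_cong:
  assumes "\<And>i. i < k \<Longrightarrow> v i = v' i"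
  shows "chain d N \<alpha> \<tau> \<mu> s v k = chain d N \<alpha> \<tau> \<mu> s v' k"
proof -
  have "chain_coord d s v k x i = chain_coord d s v' k x i" for x i
    using assms[of "i - 1"] by (cases "i = 0 \<or> k < i") (auto simp: chain_coord_def)
  then have "chain_coord d s v k = chain_coord d s v' k"
    by blast
  then show ?thesis by (simp add: chain_def fun_eq_iff)
qed

text \<open>In the second case the dead zone of \<open>shrink\<close> absorbs both coordinates.\<close>

lemma chain_Suc_eq:
  assumes "0 \<le> \<tau>"
    and "inner_d d (v k) x = 0 \<or>
      0 < k \<and> \<bar>inner_d d (v (k - 1)) x\<bar> \<le> \<tau> / 2 \<and> \<bar>inner_d d (v k) x\<bar> \<le> \<tau> / 2"
  shows "chain d N \<alpha> \<tau> \<mu> s v (Suc k) x = chain d N \<alpha> \<tau> \<mu> s v k x"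
proof -
  let ?z = "chain_coord d s v k x" and ?z' = "chain_coord d s v (Suc k) x"
  have z': "?z' i = (if i = Suc k then inner_d d (v k) x else ?z i)" for i
    by (auto simp: chain_coord_def le_Suc_eq)
  show ?thesis
  proof (cases "inner_d d (v k) x = 0")
    case True
    then have "?z' = ?z" by (auto simp: z' fun_eq_iff) (simp add: chain_coord_def)
    then show ?thesis by (simp add: chain_def)
  next
    case False
    with assms(2) have k: "0 < k" "\<bar>inner_d d (v (k - 1)) x\<bar> \<le> \<tau> / 2" "\<bar>inner_d d (v k) x\<bar> \<le> \<tau> / 2"
      by auto
    have "\<bar>inner_d d (v (k - 1)) x - inner_d d (v k) x\<bar> \<le> \<tau>" "\<bar>inner_d d (v (k - 1)) x\<bar> \<le> \<tau>"
      "\<bar>inner_d d (v k) x\<bar> \<le> \<tau>"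
      using k assms(1) by linarith+
    moreover have "?z k = inner_d d (v (k - 1)) x" "\<And>i. k < i \<Longrightarrow> ?z i = 0"
      using k by (simp_all add: chain_coord_def)
    \<comment> \<open>Revealing \<open>v k\<close> changes only the differences \<open>k\<close> and
      \<open>Suc k\<close>. Before and after, both lie in the dead zone; the bound \<tau> / 2 is
      needed for the difference of two products.\<close>
    ultimately have "shrink \<tau> (?z' i - ?z' (Suc i)) = shrink \<tau> (?z i - ?z (Suc i))" for i
      using assms(1) by (cases "i = k \<or> i = Suc k") (auto simp: z' shrink_eq_0)
    then show ?thesis by (simp add: chain_def)
  qed
qed

text \<open>Agreement is assumed only at the queries of the run on \<open>f\<close>; that the run on
  \<open>g\<close> asks the same points comes out of the induction.\<close>

lemma history_cong:
  assumes "\<And>t. t < T \<Longrightarrow> f (Q t (history Q f t)) = g (Q t (history Q f t))"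
  shows "t \<le> T \<Longrightarrow> history Q f t = history Q g t"
proof (induction t)
  case (Suc t)
  then have "history Q f t = history Q g t" by simp
  with assms[of t] Suc.prems show ?case by (simp add: Let_def)
qed simp

text \<open>Stage \<open>k\<close> consists of the queries \<open>k * m, \<dots>, (k + 1) * m - 1\<close>. Only at its end is \<open>v k\<close> fixed:
  orthogonal to the queries of the stage and nearly orthogonal to all earlier ones, so that no
  answer given so far has to be revised.\<close>

lemma resisting_directions:
  fixes \<alpha> \<mu> s :: real
  assumes bounded: "\<And>f t. norm_d d (Q t (history Q f t)) \<le> R" and R: "0 < R"
    and dim: "m + N + n \<le> d" "0 < n" and B: "2 * real (N * m) \<le> B" "1 < B"
    and \<tau>: "R * sqrt (2 * ln B / real n) \<le> \<tau> / 2"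
    and k: "k \<le> N"
  defines "F \<equiv> \<lambda>v k. chain d N \<alpha> \<tau> \<mu> s v k"
  shows "\<exists>v. orthonormal_d d k v \<and> (0 < k \<longrightarrow>
    (\<forall>t<k * m. \<bar>inner_d d (v (k - 1)) (Q t (history Q (F v k) t))\<bar> \<le> \<tau> / 2) \<and>
    (\<forall>t<k * m. (k - 1) * m \<le> t \<longrightarrow> inner_d d (v (k - 1)) (Q t (history Q (F v k) t)) = 0))"
  using k
proof (induction k)
  case 0
  show ?case by (simp add: orthonormal_d_def)
next
  case (Suc k)
  then obtain v where v: "orthonormal_d d k v"
    and small: "\<And>t. 0 < k \<Longrightarrow> t < k * m \<Longrightarrow> \<bar>inner_d d (v (k - 1)) (Q t (history Q (F v k) t))\<bar> \<le> \<tau> / 2"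
    by auto
  have "0 \<le> R * sqrt (2 * ln B / real n)" using R B by simp
  with \<tau> have \<tau>0: "0 \<le> \<tau>" by linarith
  define q where "q t = Q t (history Q (F v k) t)" for t
  \<comment> \<open>The exact constraints: the \<open>k\<close> directions already fixed, then the
    \<open>m\<close> queries of stage \<open>k\<close>. The queries of earlier stages get only the
    flat bound.\<close>
  define w where "w i = (if i < k then v i else q (k * m + (i - k)))" for i
  have p: "(k + m) + n \<le> d" using dim Suc.prems by simp
  have "k * m \<le> N * m" using Suc.prems by (intro mult_le_mono1) simp
  then have "2 * real (card {..<k * m}) \<le> B"
    using B(1) by (smt (verit) card_lessThan of_nat_mono)
  then obtain u where u: "u \<in> Rd d" "inner_d d u u = 1" "\<And>i. i < k + m \<Longrightarrow> inner_d d (w i) u = 0"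
    "\<And>t. t < k * m \<Longrightarrow> \<bar>inner_d d u (q t)\<bar> \<le> R * sqrt (2 * ln B / real n)"
    using unit_vector_orthogonal_and_flat[of "k + m" n d "{..<k * m}" B R q w, OF p dim(2) _ _ B(2) R]
      bounded by (auto simp: q_def)
  have u_v: "inner_d d (v i) u = 0" if "i < k" for i
    using u(3)[of i] that by (simp add: w_def)
  have u_q: "inner_d d u (q t) = 0" if "k * m \<le> t" "t < Suc k * m" for t
  proof -
    obtain l where "t = k * m + l" using \<open>k * m \<le> t\<close> by (auto simp: le_iff_add)
    then show ?thesis
      using u(3)[of "k + l"] that by (simp add: w_def inner_d_commute)
  qed
  have u_small: "\<bar>inner_d d u (q t)\<bar> \<le> \<tau> / 2" if "t < Suc k * m" for t
    using u(4)[of t] u_q[of t] \<tau> \<tau>0 that by (cases "t < k * m") force+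
  define v' where "v' = v(k := u)"
  \<comment> \<open>Queries of the current stage are orthogonal to \<open>u\<close>; earlier ones
    have small products with \<open>u\<close> and with its neighbour \<open>v (k - 1)\<close>, the
    only revealed direction that shares a difference with \<open>u\<close>. Hence the induction
    keeps a bound for \<open>v (k - 1)\<close> alone.\<close>
  have eq: "F v' (Suc k) (q t) = F v k (q t)" if t: "t < Suc k * m" for t
  proof -
    have "F v' (Suc k) (q t) = F v' k (q t)"
      unfolding F_def
    proof (rule chain_Suc_eq[OF \<tau>0], cases "t < k * m")
      case True
      then have "0 < k" "k - 1 \<noteq> k" by (cases k; simp)+
      then show "inner_d d (v' k) (q t) = 0 \<or> 0 < k \<and> \<bar>inner_d d (v' (k - 1)) (q t)\<bar> \<le> \<tau> / 2 \<and>
          \<bar>inner_d d (v' k) (q t)\<bar> \<le> \<tau> / 2"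
        using small[OF _ True] u_small[OF t] by (simp add: v'_def q_def)
    next
      case False
      then show "inner_d d (v' k) (q t) = 0 \<or> 0 < k \<and> \<bar>inner_d d (v' (k - 1)) (q t)\<bar> \<le> \<tau> / 2 \<and>
          \<bar>inner_d d (v' k) (q t)\<bar> \<le> \<tau> / 2"
        using u_q[of t] t by (simp add: v'_def)
    qed
    also have "F v' k = F v k"
      unfolding F_def by (rule chain_cong) (simp add: v'_def)
    finally show ?thesis .
  qed
  have "history Q (F v k) t = history Q (F v' (Suc k)) t" if "t \<le> Suc k * m" for t
    using eq by (intro history_cong[OF _ that]) (simp add: q_def)
  then have q': "Q t (history Q (F v' (Suc k)) t) = q t" if "t < Suc k * m" for t
    using that by (simp add: q_def)
  have "orthonormal_d d (Suc k) v'"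
    unfolding v'_def using v u u_v by (intro orthonormal_d_Suc) auto
  moreover have "v' k = u" by (simp add: v'_def)
  ultimately show ?case
    using u_small u_q q' by (intro exI[of _ v']) simp
qed

text \<open>All differences vanish where every hidden coordinate equals \<open>s\<close>, and
  \<open>s\<close> is such that this point has norm R / 2.\<close>

lemma chain_objective:
  assumes v: "orthonormal_d d N v" and N: "0 < N" and R: "0 < R" and \<mu>: "0 < \<mu>"
    and \<alpha>: "0 \<le> \<alpha>" "4 * \<alpha> + \<mu> \<le> \<beta>" and \<tau>: "0 \<le> \<tau>" and s: "s = R / (2 * sqrt (real N))"
  defines "f \<equiv> chain d N \<alpha> \<tau> \<mu> s v N"
  shows "f \<in> objective_class d R \<mu> \<beta>" "f (arg_min_on f (Rd d)) \<le> \<mu> * R\<^sup>2 / 8"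
proof -
  define w where "w i = (if i = 0 then (\<lambda>j. - v 0 j) else v (i - 1) - v i)" for i
  define c where "c i = (if i = 0 then s else 0)" for i :: nat
  define x0 where "x0 = (\<lambda>j. \<Sum>i<N. s * v i j)"
  have inner_w: "inner_d d (w 0) x = - inner_d d (v 0) x"
    "inner_d d (w (Suc i)) x = inner_d d (v i) x - inner_d d (v (Suc i)) x" for i x
    by (simp_all add: w_def inner_d_diff_left) (simp add: inner_d_def sum_negf)
  have f: "f = ridge_sum d N \<alpha> \<tau> \<mu> c w"
  proof
    fix x
    have "chain_coord d s v N x i - chain_coord d s v N x (Suc i) = c i + inner_d d (w i) x" if "i < N" for i
      using that by (cases i) (simp_all add: chain_coord_def c_def inner_w)
    then show "f x = ridge_sum d N \<alpha> \<tau> \<mu> c w x"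
      by (simp add: f_def chain_def ridge_sum_def)
  qed
  have v_Rd: "v i \<in> Rd d" if "i < N" for i
    using v that by (simp add: orthonormal_d_def)
  have w_Rd: "w i \<in> Rd d" if "i < N" for i
    using v_Rd[of i] v_Rd[of "i - 1"] N that by (auto simp: w_def in_Rd_iff)
  have frame: "(\<Sum>i<N. (inner_d d (w i) x)\<^sup>2) \<le> 4 * (norm_d d x)\<^sup>2" for x
  proof -
    \<comment> \<open>Squares of the coordinates, with 0 for the constant one. Each coordinate
      occurs in at most two differences, and (p - q)^2 \<le> 2 * p^2 + 2 * q^2; together this gives
      the frame bound 4.\<close>
    define a where "a i = (if i = 0 then 0 else (inner_d d (v (i - 1)) x)\<^sup>2)" for i
    have "(inner_d d (w i) x)\<^sup>2 \<le> 2 * a i + 2 * a (Suc i)" for i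
    proof (cases i)
      case (Suc j)
      have "0 \<le> (inner_d d (v j) x + inner_d d (v i) x)\<^sup>2" by simp
      then show ?thesis
        using Suc by (simp add: inner_w a_def power2_eq_square algebra_simps)
    qed (simp add: inner_w a_def)
    then have "(\<Sum>i<N. (inner_d d (w i) x)\<^sup>2) \<le> (\<Sum>i<N. 2 * a i + 2 * a (Suc i))"
      by (intro sum_mono)
    also have "\<dots> = 2 * (\<Sum>i<N. a i) + 2 * (\<Sum>i<N. a (Suc i))"
      by (simp add: sum.distrib sum_distrib_left)
    also have "(\<Sum>i<N. a i) \<le> (\<Sum>i<N. a (Suc i))"
    proof -
      have "(\<Sum>i<N. a i) \<le> (\<Sum>i<Suc N. a i)" by (simp add: a_def)
      also have "\<dots> = (\<Sum>i<N. a (Suc i))"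
        unfolding sum.lessThan_Suc_shift by (simp add: a_def)
      finally show ?thesis .
    qed
    also have "(\<Sum>i<N. a (Suc i)) \<le> (norm_d d x)\<^sup>2"
      using bessel_inequality[OF v, of x] by (simp add: a_def norm_d_sq)
    finally show ?thesis by simp
  qed
  have inner_x0: "inner_d d (v i) x0 = s" if "i < N" for i
  proof -
    have "inner_d d (v i) x0 = (\<Sum>j<N. s * inner_d d (v i) (v j))"
      by (simp add: x0_def inner_d_sum_right inner_d_scale_right)
    also have "\<dots> = (\<Sum>j<N. if j = i then s else 0)"
      using v that by (intro sum.cong) (auto simp: orthonormal_d_def)
    finally show ?thesis using that by simp
  qed
  have c_x0: "c i + inner_d d (w i) x0 = 0" if "i < N" for i
    using inner_x0[of i] inner_x0[of "i - 1"] that by (cases i) (simp_all add: c_def inner_w)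
  have "(norm_d d x0)\<^sup>2 = (\<Sum>i<N. s * s)"
    unfolding norm_d_sq x0_def by (rule inner_d_orthonormal_combination[OF v])
  also have "\<dots> = (R / 2)\<^sup>2"
    using N by (simp add: s power2_eq_square)
  finally have "norm_d d x0 = R / 2"
    using R by (simp add: power2_eq_iff_nonneg)
  moreover have "x0 \<in> Rd d"
    using v_Rd by (simp add: x0_def in_Rd_iff)
  ultimately have "x0 \<in> cball_d d (R / 2)" by (simp add: cball_d_def)
  note * = ridge_sum_objective[OF w_Rd frame \<alpha>(1) \<tau> \<mu> \<alpha>(2) R this c_x0]
  show "f \<in> objective_class d R \<mu> \<beta>" "f (arg_min_on f (Rd d)) \<le> \<mu> * R\<^sup>2 / 8"
    unfolding f using * by blast+
qed

text \<open>If the last coordinate is 0, the \<open>N\<close> differences add up to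
  \<open>s\<close>. By convexity the cheapest way is s / N each, of which the dead zone absorbs
  \<tau>.\<close>

lemma chain_ge:
  assumes N: "0 < N" and \<alpha>: "0 \<le> \<alpha>" and \<mu>: "0 \<le> \<mu>" and \<tau>: "0 \<le> \<tau>" "real N * \<tau> \<le> s"
    and last: "inner_d d (v (N - 1)) x = 0"
  shows "\<alpha> * (real N * ((s / real N - \<tau>)\<^sup>2 / 2)) \<le> chain d N \<alpha> \<tau> \<mu> s v N x"
proof -
  let ?z = "chain_coord d s v N x"
  define a where "a = s / real N - \<tau>"
  define y where "y i = ?z i - ?z (Suc i)" for i
  have a: "0 \<le> a" using N \<tau>(2) by (simp add: a_def field_simps)
  have "(\<Sum>i<N. y i) = ?z 0 - ?z N"
    unfolding y_def by (rule sum_lessThan_telescope')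
  also have "\<dots> = s"
    using N last by (simp add: chain_coord_def)
  finally have sum_y: "(\<Sum>i<N. y i) = s" .
  have "real N * (a\<^sup>2 / 2) = a * (s - real N * \<tau>) - real N * (a\<^sup>2 / 2)"
    using N by (simp add: a_def power2_eq_square field_simps)
  also have "\<dots> = (\<Sum>i<N. a * (y i - \<tau>) - a\<^sup>2 / 2)"
    by (simp add: sum_subtractf sum_y flip: sum_distrib_left)
  also have "\<dots> \<le> (\<Sum>i<N. (shrink \<tau> (y i))\<^sup>2 / 2)"
    by (intro sum_mono shrink_square_ge a \<tau>(1))
  finally have "\<alpha> * (real N * (a\<^sup>2 / 2)) \<le> \<alpha> * (\<Sum>i<N. (shrink \<tau> (y i))\<^sup>2 / 2)"
    using \<alpha> by (rule mult_left_mono)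
  moreover have "0 \<le> \<mu> / 2 * (norm_d d x)\<^sup>2" using \<mu> by simp
  ultimately show ?thesis
    unfolding chain_def a_def y_def by linarith
qed

section \<open>From an algorithm to an endless sequence of queries\<close>

lemma in_space_query_space: "x \<in> space (query_space d R) \<longleftrightarrow> x \<in> cball_d d R"
  by (simp add: query_space_def space_restrict_space)

lemma history_in_space:
  assumes "is_algorithm d R T Q Qout" "t \<le> T"
  shows "history Q f t \<in> space (history_space d R t)"
  using assms(2)
proof (induction t)
  case 0
  show ?case by (simp add: history_space_def space_PiM)
next
  case (Suc t)
  then have h: "history Q f t \<in> space (history_space d R t)" by simp
  moreover have "Q t \<in> measurable (history_space d R t) (query_space d R)"
    using assms Suc.prems by (simp add: is_algorithm_def)
  ultimately have "Q t (history Q f t) \<in> space (query_space d R)"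
    by (rule measurable_space[rotated])
  with h show ?case
    by (auto simp: history_space_def space_PiM space_pair_measure Let_def PiE_iff extensional_def
      less_Suc_eq)
qed

lemma resisting_oracle:
  assumes alg: "is_algorithm d R T Q Qout" and budget: "T < N * m"
    and R: "0 < R" and \<mu>: "0 < \<mu>" "2 * \<mu> \<le> \<beta>"
    and dim: "m + N + n \<le> d" "0 < n" and B: "2 * real (N * m) \<le> B" "1 < B"
    and flat: "128 * real N ^ 3 * ln B \<le> real n"
  shows "\<exists>f\<in>objective_class d R \<mu> \<beta>.
    \<beta> * R\<^sup>2 / (256 * (real N)\<^sup>2) - \<mu> * R\<^sup>2 / 8 \<le> f (output_point T Q Qout f) - f (arg_min_on f (Rd d))"
proof -
  have N: "0 < N" and m: "0 < m" using budget by (auto intro: Nat.gr0I)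
  define s where "s = R / (2 * sqrt (real N))"
  \<comment> \<open>Half of the mean drop s / N, so that the other half is still paid for.\<close>
  define \<tau> where "\<tau> = s / (2 * real N)"
  have s: "0 < s" and \<tau>: "0 \<le> \<tau>" using R N by (simp_all add: s_def \<tau>_def)
  \<comment> \<open>After its budget is spent the algorithm keeps querying its output. The output
    thus becomes a query of the last stage and is orthogonal to the last direction. Restriction
    resets later entries to \<open>undefined\<close>, so \<open>Qout\<close> sees exactly the
    extensional history of length \<open>T\<close>.\<close>
  define Q' where "Q' t h = (if t < T then Q t h else Qout (restrict h {..<T}))" for t h
  have hist: "history Q' f t = history Q f t" if "t \<le> T" for f t
    using that by (induction t) (simp_all add: Q'_def Let_def)
  have restr: "restrict (history Q' f t) {..<T} = history Q f T" if "T \<le> t" for f t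
    using that
  proof (induction t rule: dec_induct)
    case base
    have "history Q f T \<in> extensional {..<T}"
      using history_in_space[OF alg, of T f] by (simp add: history_space_def space_PiM PiE_iff)
    then show ?case by (simp add: hist extensional_restrict)
  next
    case (step t)
    have "restrict (history Q' f (Suc t)) {..<T} = restrict (history Q' f t) {..<T}"
      using step.hyps by (simp add: Let_def restrict_def fun_eq_iff)
    with step.IH show ?case by simp
  qed
  have bounded: "norm_d d (Q' t (history Q' f t)) \<le> R" for f t
  proof -
    have "Q' t (history Q' f t) \<in> space (query_space d R)"
    proof (cases "t < T")
      case True
      then have "Q t \<in> measurable (history_space d R t) (query_space d R)"
        using alg by (simp add: is_algorithm_def)
      then show ?thesis
        using True measurable_space[OF _ history_in_space[OF alg, of t f]] by (simp add: Q'_def hist)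
    next
      case False
      have "Qout \<in> measurable (history_space d R T) (query_space d R)"
        using alg by (simp add: is_algorithm_def)
      then show ?thesis
        using False measurable_space[OF _ history_in_space[OF alg, of T f]] by (simp add: Q'_def restr)
    qed
    then show ?thesis by (simp add: in_space_query_space cball_d_def)
  qed
  \<comment> \<open>Squared, this is the hypothesis \<open>flat\<close>, as (\<tau> / 2)^2 = R^2 /
    (64 * N^3).\<close>
  have "R * sqrt (2 * ln B / real n) \<le> \<tau> / 2"
  proof (rule power2_le_imp_le)
    have "2 * ln B / real n \<le> 1 / (64 * real N ^ 3)"
      using flat dim(2) N by (simp add: field_simps)
    then have "R\<^sup>2 * (2 * ln B / real n) \<le> R\<^sup>2 * (1 / (64 * real N ^ 3))"
      by (intro mult_left_mono) auto
    also have "\<dots> = (\<tau> / 2)\<^sup>2"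
      using N by (simp add: \<tau>_def s_def power_divide power_mult_distrib) (simp add: power2_eq_square power3_eq_cube)
    finally show "(R * sqrt (2 * ln B / real n))\<^sup>2 \<le> (\<tau> / 2)\<^sup>2"
      using B dim by (simp add: power_mult_distrib)
    show "0 \<le> \<tau> / 2" using \<tau> by simp
  qed
  then obtain v where v: "orthonormal_d d N v" and orth: "\<And>t. t < N * m \<Longrightarrow> (N - 1) * m \<le> t \<Longrightarrow>
      inner_d d (v (N - 1)) (Q' t (history Q' (chain d N (\<beta> / 8) \<tau> \<mu> s v N) t)) = 0"
    using resisting_directions[of d Q' R m N n B \<tau> N "\<beta> / 8" \<mu> s, OF bounded R dim B] N by auto
  \<comment> \<open>The weight \<beta> / 8 uses half of the smoothness budget, since 4 * (\<beta> /
    8) = \<beta> / 2; the other half covers \<mu>.\<close>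
  define f where "f = chain d N (\<beta> / 8) \<tau> \<mu> s v N"
  have f: "f \<in> objective_class d R \<mu> \<beta>" "f (arg_min_on f (Rd d)) \<le> \<mu> * R\<^sup>2 / 8"
    using chain_objective[OF v N R \<mu>(1) _ _ \<tau> s_def, of "\<beta> / 8" \<beta>] \<mu> by (simp_all add: f_def)
  define t where "t = N * m - 1"
  have t: "t < N * m" "(N - 1) * m \<le> t" "T \<le> t"
    using budget N m by (simp_all add: t_def diff_mult_distrib)
  have "Q' t (history Q' f t) = output_point T Q Qout f"
    using t by (simp add: Q'_def restr output_point_def)
  then have "inner_d d (v (N - 1)) (output_point T Q Qout f) = 0"
    using orth[OF t(1,2)] by (simp add: f_def)
  then have "\<beta> / 8 * (real N * ((s / real N - \<tau>)\<^sup>2 / 2)) \<le> f (output_point T Q Qout f)"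
    unfolding f_def using N \<mu> \<tau> s by (intro chain_ge) (simp_all add: \<tau>_def)
  moreover have "\<beta> / 8 * (real N * ((s / real N - \<tau>)\<^sup>2 / 2)) = \<beta> * R\<^sup>2 / (256 * (real N)\<^sup>2)"
  proof -
    have "s / real N - \<tau> = s / (2 * real N)" using N by (simp add: \<tau>_def field_simps)
    moreover have "s\<^sup>2 = R\<^sup>2 / (4 * real N)" using N by (simp add: s_def power_divide power_mult_distrib)
    ultimately show ?thesis using N by (simp add: power_divide power_mult_distrib power2_eq_square field_simps)
  qed
  ultimately show ?thesis using f by (intro bexI[of _ f]) auto
qed

lemma budget_lower_bound:
  assumes alg: "is_algorithm d R T Q Qout"
    and err: "\<And>f. f \<in> objective_class d R \<mu> \<beta> \<Longrightarrow> f (output_point T Q Qout f) - f (arg_min_on f (Rd d)) \<le> \<epsilon>"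
    and d: "32 \<le> d" and pos: "0 < R" "0 < \<mu>" "0 < \<epsilon>" and \<mu>: "\<mu> * R\<^sup>2 \<le> \<epsilon>"
  defines "K \<equiv> \<beta> * R\<^sup>2 / \<epsilon>"
  assumes K: "1024 \<le> K" "K \<le> (real d / ln (exp 1 * real d)) powr (2 / 3)"
  shows "real d * sqrt K / 1024 \<le> real T"
proof (rule ccontr)
  assume "\<not> ?thesis"
  then have T: "real T < real d * sqrt K / 1024" by simp
  \<comment> \<open>The divisor 32 gives 256 * N^2 \<le> K / 4, hence an error of at least 4 *
    \<epsilon> - \<epsilon> / 8. With \<open>m\<close> of order d / 4 the budget N * m is at least d
    * sqrt K / 512.\<close>
  define N where "N = nat \<lfloor>sqrt K / 32\<rfloor>"
  define m where "m = d div 4"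
  have "sqrt 1024 \<le> sqrt K" using K(1) by (rule real_sqrt_le_mono)
  moreover have "sqrt 1024 = (32 :: real)" by (rule real_sqrt_unique) simp_all
  ultimately have sK: "32 \<le> sqrt K" by simp
  have N: "real N \<le> sqrt K / 32" "sqrt K / 64 \<le> real N" "1 \<le> real N"
  proof -
    have "1 \<le> \<lfloor>sqrt K / 32\<rfloor>" using sK by (simp add: le_floor_iff)
    moreover have "real N = of_int \<lfloor>sqrt K / 32\<rfloor>" using K(1) by (simp add: N_def)
    ultimately show "real N \<le> sqrt K / 32" "sqrt K / 64 \<le> real N" "1 \<le> real N"
      using sK floor_correct[of "sqrt K / 32"] by linarith+
  qed
  have m: "real m \<le> real d / 4" "real d / 8 \<le> real m"
    using d by (simp_all add: m_def)
  define L where "L = ln (exp 1 * real d)"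
  have L: "L = 1 + ln (real d)" "1 \<le> L"
    using d by (simp_all add: L_def ln_mult)
  \<comment> \<open>The dimension hypothesis raised to the power 3 / 2 bounds N^3, because N is of
    order sqrt K.\<close>
  have "K powr (3 / 2) \<le> ((real d / L) powr (2 / 3)) powr (3 / 2)"
    using K by (intro powr_mono2) (auto simp: L_def)
  also have "\<dots> = real d / L" using L by (simp add: powr_powr)
  also have "K powr (3 / 2) = sqrt K ^ 3"
    using K(1) by (simp add: powr_half_sqrt[symmetric] powr_powr flip: powr_realpow)
  finally have sK3: "sqrt K ^ 3 \<le> real d / L" .
  have "real N ^ 3 \<le> (sqrt K / 32) ^ 3" using N by (intro power_mono) auto
  also have "\<dots> \<le> real d / L / 32768" using sK3 by (simp add: power_divide)
  finally have N3L: "real N ^ 3 * L \<le> real d / 32768" using L by (simp add: field_simps)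
  have "real N ^ 1 \<le> real N ^ 3" using N by (intro power_increasing) auto
  also have "\<dots> * 1 \<le> real N ^ 3 * L" using L by (intro mult_left_mono) auto
  finally have Nd: "real N \<le> real d / 32768" using N3L by simp
  define n where "n = d - m - N"
  have "real (m + N) \<le> real d / 2" using m Nd by simp
  then have n: "m + N + n \<le> d" "real d / 2 \<le> real n" "0 < n"
    using d unfolding n_def by linarith+
  have "real d * sqrt K / 512 = real d / 8 * (sqrt K / 64)" by simp
  also have "\<dots> \<le> real m * real N" using m N sK K(1) by (intro mult_mono) auto
  also have "\<dots> = real (N * m)" by simp
  finally have "real d * sqrt K / 512 \<le> real (N * m)" .
  moreover have "0 \<le> real d * sqrt K" using K(1) by simp
  ultimately have "real T < real (N * m)" using T by linarith
  then have budget: "T < N * m" by (simp only: of_nat_less_iff)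
  \<comment> \<open>There may be more than d queries, but fewer than d^2; taking B = d^2 costs only
    a factor 2 in the logarithm.\<close>
  have "real N * real m \<le> (real d / 2) * real d"
    using Nd m by (intro mult_mono) linarith+
  then have B: "2 * real (N * m) \<le> (real d)\<^sup>2" by (simp add: power2_eq_square)
  have d2: "1 < (real d)\<^sup>2" using d by (intro one_less_power) auto
  have "128 * real N ^ 3 * ln ((real d)\<^sup>2) \<le> 256 * (real N ^ 3 * L)"
  proof -
    have "ln ((real d)\<^sup>2) \<le> 2 * L" using d L by (simp add: ln_realpow)
    then have "128 * real N ^ 3 * ln ((real d)\<^sup>2) \<le> 128 * real N ^ 3 * (2 * L)"
      by (intro mult_left_mono) auto
    then show ?thesis by simp
  qed
  then have flat: "128 * real N ^ 3 * ln ((real d)\<^sup>2) \<le> real n"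
    using N3L n(2) by linarith
  have \<mu>\<beta>: "2 * \<mu> \<le> \<beta>"
  proof -
    have "\<epsilon> * 1024 \<le> \<beta> * R\<^sup>2" using K(1) pos by (simp add: K_def field_simps)
    then have "2 * \<mu> * R\<^sup>2 \<le> \<beta> * R\<^sup>2" using \<mu> pos by linarith
    then show ?thesis using pos by simp
  qed
  obtain f where f: "f \<in> objective_class d R \<mu> \<beta>"
    "\<beta> * R\<^sup>2 / (256 * (real N)\<^sup>2) - \<mu> * R\<^sup>2 / 8 \<le> f (output_point T Q Qout f) - f (arg_min_on f (Rd d))"
    using resisting_oracle[OF alg budget pos(1,2) \<mu>\<beta> n(1,3) B d2 flat] by blast
  have "(real N)\<^sup>2 \<le> (sqrt K / 32)\<^sup>2" using N by (intro power_mono) auto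
  then have "256 * (real N)\<^sup>2 \<le> K / 4" using K(1) by (simp add: power_divide)
  then have "\<beta> * R\<^sup>2 / (K / 4) \<le> \<beta> * R\<^sup>2 / (256 * (real N)\<^sup>2)"
    using N K(1) \<mu>\<beta> pos by (intro divide_left_mono) auto
  moreover have "\<beta> * R\<^sup>2 / (K / 4) = 4 * \<epsilon>"
    using K(1) pos \<mu>\<beta> by (simp add: K_def field_simps)
  ultimately show False using f err[OF f(1)] \<mu> pos by linarith
qed

subsection \<open>Accelerated descent with finite differences\<close>

definition proj_ball :: "nat \<Rightarrow> real \<Rightarrow> point \<Rightarrow> point" where
  "proj_ball d r u = (if norm_d d u \<le> r then u else (\<lambda>i. r / norm_d d u * u i))"

lemma proj_ball_in_cball:
  assumes "u \<in> Rd d" "0 \<le> r"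
  shows "proj_ball d r u \<in> cball_d d r"
proof (cases "norm_d d u \<le> r")
  case False
  then have "norm_d d (\<lambda>i. r / norm_d d u * u i) = r"
    unfolding norm_d_scale using assms by auto
  then show ?thesis
    using assms False by (simp only: proj_ball_def cball_d_def) (simp add: in_Rd_iff)
qed (use assms in \<open>simp add: proj_ball_def cball_d_def\<close>)

text \<open>The variational inequality of the projection. Outside the ball the residual is a
  nonnegative multiple of \<open>u\<close>, and Cauchy-Schwarz finishes.\<close>

lemma proj_ball_obtuse:
  assumes "0 \<le> r" "norm_d d a \<le> r"
  shows "inner_d d (u - proj_ball d r u) (a - proj_ball d r u) \<le> 0"
proof (cases "norm_d d u \<le> r")
  case True
  then have "u - proj_ball d r u = (\<lambda>_. 0)" by (simp add: proj_ball_def fun_eq_iff)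
  then show ?thesis by (simp add: inner_d_def)
next
  case False
  define c where "c = r / norm_d d u"
  have pos: "0 < norm_d d u" using False assms by linarith
  have c: "c \<le> 1" using False pos by (simp add: c_def)
  have p: "proj_ball d r u = (\<lambda>i. c * u i)" using False by (simp add: proj_ball_def c_def)
  have "u - proj_ball d r u = (\<lambda>i. (1 - c) * u i)"
    by (simp add: p fun_eq_iff algebra_simps)
  then have "inner_d d (u - proj_ball d r u) (a - proj_ball d r u)
      = (1 - c) * (inner_d d u a - c * inner_d d u u)"
    by (simp only: inner_d_scale_left inner_d_diff_right) (simp only: p inner_d_scale_right)
  also have "c * inner_d d u u = r * norm_d d u"
    using pos by (simp add: c_def power2_eq_square flip: norm_d_sq)
  also have "(1 - c) * (inner_d d u a - r * norm_d d u) \<le> 0"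
  proof -
    have "norm_d d u * norm_d d a \<le> norm_d d u * r"
      by (intro mult_left_mono assms(2)) simp
    then have "inner_d d u a - r * norm_d d u \<le> 0"
      using inner_d_le[of d u a] by (simp add: mult.commute)
    then show ?thesis using c by (simp add: mult_le_0_iff)
  qed
  finally show ?thesis .
qed

text \<open>The optimality condition of the mirror step, with its inner product rewritten by
  polarization into squared distances that telescope over the rounds.\<close>

lemma proj_ball_three_points:
  fixes z g :: point
  assumes "0 \<le> r" "norm_d d a \<le> r" "0 < c"
  defines "z' \<equiv> proj_ball d r (\<lambda>i. z i - g i / c)"
  shows "inner_d d g (z' - a)
    \<le> c / 2 * ((norm_d d (z - a))\<^sup>2 - (norm_d d (z' - a))\<^sup>2 - (norm_d d (z' - z))\<^sup>2)"
proof -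
  define u where "u = (\<lambda>i. z i - g i / c)"
  have u: "u = z - (\<lambda>i. (1 / c) * g i)" by (simp add: u_def fun_eq_iff)
  have "inner_d d (u - z') (a - z') \<le> 0"
    unfolding z'_def u_def by (rule proj_ball_obtuse[OF assms(1,2)])
  then have "c * inner_d d (u - z') (a - z') \<le> 0"
    using assms(3) by (simp add: mult_le_0_iff)
  also have "c * inner_d d (u - z') (a - z')
      = c * inner_d d (z - z') (a - z') - inner_d d g (a - z')"
    using assms(3) by (simp only: u inner_d_diff_left inner_d_scale_left) (simp add: algebra_simps)
  finally have "c * inner_d d (z - z') (a - z') \<le> inner_d d g (a - z')" by simp
  then show ?thesis
    by (simp add: norm_d_sq inner_d_diff_left inner_d_diff_right inner_d_commute[of d a z']
      inner_d_commute[of d z z'] inner_d_commute[of d a z] algebra_simps add_divide_distrib diff_divide_distrib)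
qed

text \<open>The constant \<open>2 * \<beta>\<close> in the step size compensates for the weak form of \<open>descent_inequality\<close>.\<close>

lemma accelerated_step:
  assumes convex: "\<And>a b. a \<in> Rd d \<Longrightarrow> b \<in> Rd d \<Longrightarrow> f a + inner_d d (G a) (b - a) \<le> f b"
    and lipschitz: "\<And>a b. a \<in> Rd d \<Longrightarrow> b \<in> Rd d \<Longrightarrow> norm_d d (G a - G b) \<le> \<beta> * norm_d d (a - b)"
    and \<beta>: "0 < \<beta>" and \<theta>: "0 < \<theta>" "\<theta> \<le> 1" and r: "0 \<le> r"
    and a: "a \<in> cball_d d r" and x: "x \<in> Rd d" and z: "z \<in> Rd d" and g: "g \<in> Rd d"
    and y: "y = (\<lambda>i. (1 - \<theta>) * x i + \<theta> * z i)"
    and err: "norm_d d (g - G y) \<le> \<delta>"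
    and z': "z' = proj_ball d r (\<lambda>i. z i - g i / (2 * \<beta> * \<theta>))"
    and x': "x' = (\<lambda>i. (1 - \<theta>) * x i + \<theta> * z' i)"
  shows "f x' - f a \<le> (1 - \<theta>) * (f x - f a)
    + \<beta> * \<theta>\<^sup>2 * ((norm_d d (z - a))\<^sup>2 - (norm_d d (z' - a))\<^sup>2) + 2 * r * \<delta> * \<theta>"
proof -
  have aR: "a \<in> Rd d" "norm_d d a \<le> r" using a by (auto simp: cball_d_def)
  have z'_ball: "z' \<in> cball_d d r"
    unfolding z' using z g r by (intro proj_ball_in_cball) (auto simp: in_Rd_iff)
  then have z'R: "z' \<in> Rd d" "norm_d d z' \<le> r" by (auto simp: cball_d_def)
  have yR: "y \<in> Rd d" using x z by (simp add: y in_Rd_iff)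
  have x'R: "x' \<in> Rd d" using x z'R by (simp add: x' in_Rd_iff)
  have "x' - y = (\<lambda>i. \<theta> * (z' - z) i)"
    by (simp add: x' y fun_eq_iff algebra_simps)
  then have nx': "norm_d d (x' - y) = \<theta> * norm_d d (z' - z)"
    using \<theta> by (simp only: norm_d_scale abs_of_pos)
  have descent: "f x' \<le> f y + inner_d d (G y) (x' - y) + \<beta> * (norm_d d (x' - y))\<^sup>2"
    by (rule descent_inequality[OF convex[OF x'R yR] lipschitz[OF yR x'R]])
  \<comment> \<open>The gradient term splits so that convexity handles the parts towards
    \<open>x\<close> and \<open>a\<close>, and the mirror step the part with
    \<open>z'\<close>.\<close>
  have split: "inner_d d (G y) (x' - y)
      = (1 - \<theta>) * inner_d d (G y) (x - y) + \<theta> * inner_d d (G y) (a - y) + \<theta> * inner_d d (G y) (z' - a)"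
  proof -
    have "inner_d d (G y) x' = (1 - \<theta>) * inner_d d (G y) x + \<theta> * inner_d d (G y) z'"
      by (simp only: x' inner_d_add_right inner_d_scale_right)
    then show ?thesis by (simp only: inner_d_diff_right) (simp add: algebra_simps)
  qed
  have "(1 - \<theta>) * (f y + inner_d d (G y) (x - y)) \<le> (1 - \<theta>) * f x"
    using \<theta> by (intro mult_left_mono convex yR x) auto
  moreover have "\<theta> * (f y + inner_d d (G y) (a - y)) \<le> \<theta> * f a"
    using \<theta> by (intro mult_left_mono convex yR aR) auto
  moreover have "\<theta> * inner_d d (G y) (z' - a) \<le> \<theta> * (2 * \<beta> * \<theta> / 2 *
      ((norm_d d (z - a))\<^sup>2 - (norm_d d (z' - a))\<^sup>2 - (norm_d d (z' - z))\<^sup>2) + 2 * r * \<delta>)"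
  proof (intro mult_left_mono)
    have "inner_d d g (z' - a) \<le> 2 * \<beta> * \<theta> / 2 *
        ((norm_d d (z - a))\<^sup>2 - (norm_d d (z' - a))\<^sup>2 - (norm_d d (z' - z))\<^sup>2)"
      unfolding z' using \<beta> \<theta> by (intro proj_ball_three_points r aR) auto
    \<comment> \<open>The gradient error is paid at most over the diameter 2 * r of the ball, which
      is why the mirror iterates are projected.\<close>
    moreover have "inner_d d (G y - g) (z' - a) \<le> 2 * r * \<delta>"
    proof -
      have "norm_d d (z' - a) = norm_d d (\<lambda>i. z' i + (\<lambda>i. - 1 * a i) i)"
        by (rule arg_cong[where f = "norm_d d"]) (simp add: fun_eq_iff)
      also have "\<dots> \<le> norm_d d z' + norm_d d (\<lambda>i. - 1 * a i)"
        by (rule norm_d_triangle)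
      also have "\<dots> \<le> 2 * r"
        using z'R aR unfolding norm_d_scale by simp
      finally have "norm_d d (G y - g) * norm_d d (z' - a) \<le> \<delta> * (2 * r)"
        using err r by (intro mult_mono) (auto simp: norm_d_diff_commute intro: order_trans[OF norm_d_nonneg])
      then show ?thesis
        using inner_d_le[of d "G y - g" "z' - a"] by (simp add: mult_ac)
    qed
    ultimately show "inner_d d (G y) (z' - a) \<le> 2 * \<beta> * \<theta> / 2 *
        ((norm_d d (z - a))\<^sup>2 - (norm_d d (z' - a))\<^sup>2 - (norm_d d (z' - z))\<^sup>2) + 2 * r * \<delta>"
      by (simp only: inner_d_diff_left)
  qed (use \<theta> in auto)
  ultimately have "f x' \<le> (1 - \<theta>) * f x + \<theta> * f a + \<theta> * (2 * \<beta> * \<theta> / 2 *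
      ((norm_d d (z - a))\<^sup>2 - (norm_d d (z' - a))\<^sup>2 - (norm_d d (z' - z))\<^sup>2) + 2 * r * \<delta>)
      + \<beta> * (\<theta> * norm_d d (z' - z))\<^sup>2"
    using descent split nx' by (simp add: algebra_simps)
  \<comment> \<open>The terms with z' - z cancel: the descent term is \<beta> * \<theta>^2 times its
    squared norm, and the step size was chosen to give the same with a minus sign.\<close>
  also have "\<dots> = (1 - \<theta>) * f x + \<theta> * f a
      + \<beta> * \<theta>\<^sup>2 * ((norm_d d (z - a))\<^sup>2 - (norm_d d (z' - a))\<^sup>2) + 2 * r * \<delta> * \<theta>"
    by (simp add: power2_eq_square algebra_simps)
  finally show ?thesis by (simp add: algebra_simps)
qed

text \<open>A potential argument. Multiplying the bound for one step by 1 / \<theta>^2 = (k + 2)^2 /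
  4 turns the coefficient of the old error into k * (k + 2) / 4 exactly, and (k + 2)^2 \<ge> (k + 1)
  * (k + 3) lets the new one start the next round. The gradient errors add up to k * (k + 3) / 4,
  the sum of (j + 2) / 2 over j < k, which is at most twice the weight of the final error; so they
  do not accumulate.\<close>

lemma accelerated_convergence:
  fixes x z g :: "nat \<Rightarrow> point"
  defines "\<theta> \<equiv> \<lambda>k::nat. 2 / (real k + 2)"
  defines "y \<equiv> \<lambda>k i. (1 - \<theta> k) * x k i + \<theta> k * z k i"
  assumes convex: "\<And>a b. a \<in> Rd d \<Longrightarrow> b \<in> Rd d \<Longrightarrow> f a + inner_d d (G a) (b - a) \<le> f b"
    and lipschitz: "\<And>a b. a \<in> Rd d \<Longrightarrow> b \<in> Rd d \<Longrightarrow> norm_d d (G a - G b) \<le> \<beta> * norm_d d (a - b)"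
    and \<beta>: "0 < \<beta>" and r: "0 \<le> r"
    and a: "a \<in> cball_d d r" "\<And>b. b \<in> Rd d \<Longrightarrow> f a \<le> f b"
    and Rd: "\<And>k. x k \<in> Rd d" "\<And>k. z k \<in> Rd d" "\<And>k. g k \<in> Rd d" and z0: "z 0 = (\<lambda>_. 0)"
    and err: "\<And>k. k < N \<Longrightarrow> norm_d d (g k - G (y k)) \<le> \<delta>" and \<delta>: "0 \<le> \<delta>"
    and z: "\<And>k. k < N \<Longrightarrow> z (Suc k) = proj_ball d r (\<lambda>i. z k i - g k i / (2 * \<beta> * \<theta> k))"
    and x: "\<And>k. k < N \<Longrightarrow> x (Suc k) = (\<lambda>i. (1 - \<theta> k) * x k i + \<theta> k * z (Suc k) i)"
    and N: "0 < N"
  shows "f (x N) - f a \<le> 4 * \<beta> * r\<^sup>2 / (real N)\<^sup>2 + 4 * r * \<delta>"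
proof -
  define e where "e k = f (x k) - f a" for k
  define D where "D k = (norm_d d (z k - a))\<^sup>2" for k
  have e: "0 \<le> e k" for k using a(2)[OF Rd(1)] by (simp add: e_def)
  have inv: "real k * (real k + 2) / 4 * e k + \<beta> * D k
      \<le> \<beta> * D 0 + 2 * r * \<delta> * (real k * (real k + 3) / 4)" if "k \<le> N" for k
    using that
  proof (induction k)
    case (Suc k)
    define s where "s = real k + 2"
    have s: "0 < s" "\<theta> k = 2 / s" by (simp_all add: s_def \<theta>_def)
    have "e (Suc k) \<le> (1 - \<theta> k) * e k + \<beta> * (\<theta> k)\<^sup>2 * (D k - D (Suc k)) + 2 * r * \<delta> * \<theta> k"
      unfolding e_def D_def
    proof (rule accelerated_step[OF convex lipschitz \<beta> _ _ r a(1) Rd(1) Rd(2) Rd(3)])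
      show "y k = (\<lambda>i. (1 - \<theta> k) * x k i + \<theta> k * z k i)" by (simp add: y_def)
      show "norm_d d (g k - G (y k)) \<le> \<delta>" using err Suc.prems by simp
      show "0 < \<theta> k" "\<theta> k \<le> 1" by (simp_all add: \<theta>_def)
    qed (use z x Suc.prems in auto)
    then have "s\<^sup>2 / 4 * e (Suc k)
        \<le> s\<^sup>2 / 4 * ((1 - 2 / s) * e k + \<beta> * (2 / s)\<^sup>2 * (D k - D (Suc k)) + 2 * r * \<delta> * (2 / s))"
      unfolding s(2) by (rule mult_left_mono) simp
    also have "\<dots> = s * (s - 2) / 4 * e k + \<beta> * (D k - D (Suc k)) + 2 * r * \<delta> * (s / 2)"
      using s(1) by (simp add: field_simps power2_eq_square)
    finally have step: "s\<^sup>2 / 4 * e (Suc k)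
      \<le> s * (s - 2) / 4 * e k + \<beta> * (D k - D (Suc k)) + 2 * r * \<delta> * (s / 2)" .
    have "real (Suc k) * (real (Suc k) + 2) / 4 * e (Suc k) \<le> s\<^sup>2 / 4 * e (Suc k)"
      by (intro mult_right_mono e) (simp add: s_def power2_eq_square algebra_simps)
    moreover have "s * (s - 2) / 4 * e k = real k * (real k + 2) / 4 * e k"
      by (simp add: s_def mult.commute)
    moreover have "2 * r * \<delta> * (real k * (real k + 3) / 4) + 2 * r * \<delta> * (s / 2)
        \<le> 2 * r * \<delta> * (real (Suc k) * (real (Suc k) + 3) / 4)"
      unfolding distrib_left[symmetric] using r \<delta>
      by (intro mult_left_mono) (simp_all add: s_def field_simps)
    moreover have "\<beta> * (D k - D (Suc k)) = \<beta> * D k - \<beta> * D (Suc k)"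
      by (rule right_diff_distrib)
    ultimately show ?case
      using Suc.IH Suc.prems step by linarith
  qed simp
  have "D 0 = (norm_d d a)\<^sup>2"
    by (simp add: D_def z0 norm_d_diff_commute[of d _ a]) (simp add: norm_d_def L2_set_def)
  also have "\<dots> \<le> r\<^sup>2" using a(1) by (intro power_mono) (auto simp: cball_d_def)
  finally have "\<beta> * D 0 \<le> \<beta> * r\<^sup>2" using \<beta> by simp
  moreover have "0 \<le> \<beta> * D N" using \<beta> by (simp add: D_def)
  ultimately have *: "real N * (real N + 2) / 4 * e N
      \<le> \<beta> * r\<^sup>2 + 2 * r * \<delta> * (real N * (real N + 3) / 4)"
    using inv[of N] by simp
  define P where "P = real N * (real N + 2) / 4"
  have P: "0 < P" using N by (simp add: P_def)
  have P': "(real N)\<^sup>2 / 4 \<le> P" "real N * (real N + 3) / 4 \<le> 2 * P"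
    using N by (simp_all add: P_def power2_eq_square field_simps)
  have "2 * r * \<delta> * (real N * (real N + 3) / 4) \<le> 2 * r * \<delta> * (2 * P)"
    using r \<delta> by (intro mult_left_mono P') auto
  with * have "P * e N \<le> \<beta> * r\<^sup>2 + P * (4 * r * \<delta>)"
    by (simp add: P_def[symmetric] mult_ac)
  then have "e N \<le> \<beta> * r\<^sup>2 / P + 4 * r * \<delta>"
    using P by (simp add: field_simps)
  also have "\<beta> * r\<^sup>2 / P \<le> \<beta> * r\<^sup>2 / ((real N)\<^sup>2 / 4)"
    using P P' N \<beta> by (intro divide_left_mono) auto
  finally show ?thesis by (simp add: e_def mult_ac)
qed

section \<open>The algorithm as a measurable function of the history\<close>

text \<open>Only recorded values are read; the points are recomputed from them by
  \<open>agd\<close>. This reduces measurability to finitely many real-valued components of the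
  history.\<close>

definition grad_estimate :: "nat \<Rightarrow> real \<Rightarrow> history \<Rightarrow> nat \<Rightarrow> point" where
  "grad_estimate d \<eta> h k =
     (\<lambda>i. if i < d then (snd (h (k * (d + 1) + Suc i)) - snd (h (k * (d + 1)))) / \<eta> else 0)"

text \<open>The pair consists of the averaged iterate and the mirror iterate.\<close>

primrec agd :: "nat \<Rightarrow> real \<Rightarrow> real \<Rightarrow> real \<Rightarrow> history \<Rightarrow> nat \<Rightarrow> point \<times> point" where
  "agd d r \<beta> \<eta> h 0 = (\<lambda>_. 0, \<lambda>_. 0)"
| "agd d r \<beta> \<eta> h (Suc k) =
    (let \<theta> = 2 / (real k + 2); x = fst (agd d r \<beta> \<eta> h k); z = snd (agd d r \<beta> \<eta> h k);
       z' = proj_ball d r (\<lambda>i. z i - grad_estimate d \<eta> h k i / (2 * \<beta> * \<theta>))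
     in (\<lambda>i. (1 - \<theta>) * x i + \<theta> * z' i, z'))"

definition agd_centre :: "nat \<Rightarrow> real \<Rightarrow> real \<Rightarrow> real \<Rightarrow> history \<Rightarrow> nat \<Rightarrow> point" where
  "agd_centre d r \<beta> \<eta> h k = (let \<theta> = 2 / (real k + 2) in
     (\<lambda>i. (1 - \<theta>) * fst (agd d r \<beta> \<eta> h k) i + \<theta> * snd (agd d r \<beta> \<eta> h k) i))"

text \<open>Round \<open>k\<close> uses the queries \<open>k * (d + 1), \<dots>, k * (d + 1) + d\<close>: the centre, then its
  translates along the coordinate axes.\<close>

definition agd_query :: "nat \<Rightarrow> real \<Rightarrow> real \<Rightarrow> real \<Rightarrow> nat \<Rightarrow> history \<Rightarrow> point" where
  "agd_query d r \<beta> \<eta> t h = (\<lambda>i. agd_centre d r \<beta> \<eta> h (t div (d + 1)) i +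
     (if t mod (d + 1) = Suc i then \<eta> else 0))"

lemma convex_comb_cball_d:
  assumes "x \<in> cball_d d r" "z \<in> cball_d d r" "0 \<le> \<theta>" "\<theta> \<le> 1"
  shows "(\<lambda>i. (1 - \<theta>) * x i + \<theta> * z i) \<in> cball_d d r"
proof -
  have "norm_d d (\<lambda>i. (1 - \<theta>) * x i + \<theta> * z i) \<le> norm_d d (\<lambda>i. (1 - \<theta>) * x i) + norm_d d (\<lambda>i. \<theta> * z i)"
    by (rule norm_d_triangle)
  also have "\<dots> = (1 - \<theta>) * norm_d d x + \<theta> * norm_d d z"
    using assms by (simp add: norm_d_scale)
  also have "\<dots> \<le> (1 - \<theta>) * r + \<theta> * r"
    using assms by (intro add_mono mult_left_mono) (auto simp: cball_d_def)
  finally show ?thesis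
    using assms by (auto simp: cball_d_def in_Rd_iff algebra_simps)
qed

lemma grad_estimate_Rd: "grad_estimate d \<eta> h k \<in> Rd d"
  by (simp add: grad_estimate_def in_Rd_iff)

lemma agd_in_cball:
  assumes "0 \<le> r"
  shows "fst (agd d r \<beta> \<eta> h k) \<in> cball_d d r \<and> snd (agd d r \<beta> \<eta> h k) \<in> cball_d d r"
proof (induction k)
  case 0
  show ?case using assms by (simp add: cball_d_def in_Rd_iff norm_d_def L2_set_def)
next
  case (Suc k)
  then have "snd (agd d r \<beta> \<eta> h k) \<in> Rd d" by (simp add: cball_d_def)
  then have "snd (agd d r \<beta> \<eta> h (Suc k)) \<in> cball_d d r"
    using assms grad_estimate_Rd[of d \<eta> h k]
    by (auto simp: Let_def in_Rd_iff intro!: proj_ball_in_cball)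
  moreover have "fst (agd d r \<beta> \<eta> h (Suc k)) = (\<lambda>i. (1 - 2 / (real k + 2)) * fst (agd d r \<beta> \<eta> h k) i
      + 2 / (real k + 2) * snd (agd d r \<beta> \<eta> h (Suc k)) i)"
    by (simp only: agd.simps Let_def fst_conv snd_conv)
  ultimately show ?case
    using convex_comb_cball_d[of "fst (agd d r \<beta> \<eta> h k)" d r "snd (agd d r \<beta> \<eta> h (Suc k))"
      "2 / (real k + 2)"] Suc by simp
qed

lemma agd_centre_in_cball: "0 \<le> r \<Longrightarrow> agd_centre d r \<beta> \<eta> h k \<in> cball_d d r"
  unfolding agd_centre_def Let_def by (intro convex_comb_cball_d) (simp_all add: agd_in_cball)

lemma norm_d_axis: "norm_d d (\<lambda>i. if j = Suc i then \<eta> else 0) \<le> \<bar>\<eta>\<bar>"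
proof -
  have "(\<Sum>i<d. (if j = Suc i then \<eta> else 0)\<^sup>2) \<le> \<eta>\<^sup>2"
  proof (cases j)
    case (Suc l)
    then have "(\<Sum>i<d. (if j = Suc i then \<eta> else 0)\<^sup>2) = (\<Sum>i<d. if l = i then \<eta>\<^sup>2 else 0)"
      by (intro sum.cong) auto
    then show ?thesis by simp
  qed simp
  then show ?thesis
    unfolding norm_d_def L2_set_def by (metis real_sqrt_abs real_sqrt_le_mono)
qed

lemma agd_query_in_cball:
  assumes "0 \<le> r" "0 \<le> \<eta>"
  shows "agd_query d r \<beta> \<eta> t h \<in> cball_d d (r + \<eta>)"
proof -
  let ?y = "agd_centre d r \<beta> \<eta> h (t div (d + 1))" and ?e = "\<lambda>i. if t mod (d + 1) = Suc i then \<eta> else 0"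
  have y: "?y \<in> cball_d d r" by (rule agd_centre_in_cball[OF assms(1)])
  have "t mod (d + 1) < d + 1" by simp
  then have "?e \<in> Rd d" by (auto simp: in_Rd_iff simp del: mod_less_divisor)
  then have "agd_query d r \<beta> \<eta> t h \<in> Rd d"
    using y by (auto simp: agd_query_def cball_d_def in_Rd_iff)
  moreover have "norm_d d (agd_query d r \<beta> \<eta> t h) \<le> norm_d d ?y + norm_d d ?e"
    unfolding agd_query_def by (rule norm_d_triangle)
  moreover have "norm_d d ?e \<le> \<eta>" using norm_d_axis[of d "t mod (d + 1)" \<eta>] assms by simp
  ultimately show ?thesis using y by (simp add: cball_d_def)
qed

lemma agd_cong:
  assumes "\<And>t. t < k * (d + 1) \<Longrightarrow> h t = h' t"
  shows "agd d r \<beta> \<eta> h k = agd d r \<beta> \<eta> h' k"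
  using assms
proof (induction k)
  case (Suc k)
  have "grad_estimate d \<eta> h k = grad_estimate d \<eta> h' k"
    unfolding grad_estimate_def
  proof (intro ext if_cong refl)
    fix i assume "i < d"
    then show "(snd (h (k * (d + 1) + Suc i)) - snd (h (k * (d + 1)))) / \<eta>
        = (snd (h' (k * (d + 1) + Suc i)) - snd (h' (k * (d + 1)))) / \<eta>"
      using Suc.prems[of "k * (d + 1) + Suc i"] Suc.prems[of "k * (d + 1)"] by simp
  qed
  moreover have "agd d r \<beta> \<eta> h k = agd d r \<beta> \<eta> h' k"
    using Suc by simp
  ultimately show ?case by simp
qed simp

text \<open>Causality. It lets the analysis replace the partial histories of a run by its final
  history.\<close>

lemma agd_query_cong:
  assumes "\<And>t'. t' < t \<Longrightarrow> h t' = h' t'"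
  shows "agd_query d r \<beta> \<eta> t h = agd_query d r \<beta> \<eta> t h'"
proof -
  have "t div (d + 1) * (d + 1) \<le> t" by (rule div_times_less_eq_dividend)
  then have "agd d r \<beta> \<eta> h (t div (d + 1)) = agd d r \<beta> \<eta> h' (t div (d + 1))"
    using assms by (intro agd_cong) auto
  then show ?thesis by (simp add: agd_query_def agd_centre_def)
qed

lemma measurable_history_value:
  assumes "j < t"
  shows "(\<lambda>h. snd (h j)) \<in> borel_measurable (history_space d R t)"
proof -
  have "(\<lambda>h. h j) \<in> measurable (history_space d R t) (query_space d R \<Otimes>\<^sub>M borel)"
    unfolding history_space_def using assms by (intro measurable_component_singleton) simp
  then show ?thesis by (rule measurable_compose[OF _ measurable_snd])
qed

lemma measurable_grad_estimate:
  assumes "k * (d + 1) + d < t"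
  shows "(\<lambda>h. grad_estimate d \<eta> h k i) \<in> borel_measurable (history_space d R t)"
proof (cases "i < d")
  case True
  then show ?thesis
    using assms by (simp add: grad_estimate_def)
      (intro borel_measurable_divide borel_measurable_diff measurable_history_value, auto)
qed (simp add: grad_estimate_def)

lemma measurable_proj_ball:
  assumes "\<And>i. (\<lambda>h. u h i) \<in> borel_measurable M"
  shows "(\<lambda>h. proj_ball d r (u h) i) \<in> borel_measurable M"
proof -
  note [measurable] = assms
  have [measurable]: "(\<lambda>h. norm_d d (u h)) \<in> borel_measurable M"
    unfolding norm_d_def L2_set_def by measurable
  have "(\<lambda>h. if norm_d d (u h) \<le> r then u h i else r / norm_d d (u h) * u h i) \<in> borel_measurable M"
    by measurable
  moreover have "(\<lambda>h. proj_ball d r (u h) i)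
      = (\<lambda>h. if norm_d d (u h) \<le> r then u h i else r / norm_d d (u h) * u h i)"
    by (simp add: proj_ball_def fun_eq_iff)
  ultimately show ?thesis by simp
qed

lemma measurable_agd:
  assumes "k * (d + 1) \<le> t"
  shows "(\<lambda>h. fst (agd d r \<beta> \<eta> h k) i) \<in> borel_measurable (history_space d R t) \<and>
    (\<lambda>h. snd (agd d r \<beta> \<eta> h k) i) \<in> borel_measurable (history_space d R t)"
  using assms
proof (induction k arbitrary: i)
  case (Suc k)
  have IH: "(\<lambda>h. fst (agd d r \<beta> \<eta> h k) i) \<in> borel_measurable (history_space d R t)"
    "(\<lambda>h. snd (agd d r \<beta> \<eta> h k) i) \<in> borel_measurable (history_space d R t)" for i
    using Suc by simp_all
  have g: "(\<lambda>h. grad_estimate d \<eta> h k i) \<in> borel_measurable (history_space d R t)" for i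
    using Suc.prems by (intro measurable_grad_estimate) simp
  have z: "(\<lambda>h. snd (agd d r \<beta> \<eta> h (Suc k)) i) \<in> borel_measurable (history_space d R t)" for i
    unfolding agd.simps Let_def snd_conv
    by (intro measurable_proj_ball borel_measurable_diff borel_measurable_divide IH g borel_measurable_const)
  have "fst (agd d r \<beta> \<eta> h (Suc k)) i = (1 - 2 / (real k + 2)) * fst (agd d r \<beta> \<eta> h k) i
      + 2 / (real k + 2) * snd (agd d r \<beta> \<eta> h (Suc k)) i" for h
    by (simp add: Let_def)
  moreover have "(\<lambda>h. (1 - 2 / (real k + 2)) * fst (agd d r \<beta> \<eta> h k) i
      + 2 / (real k + 2) * snd (agd d r \<beta> \<eta> h (Suc k)) i) \<in> borel_measurable (history_space d R t)"
    by (intro borel_measurable_add borel_measurable_times IH z borel_measurable_const)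
  ultimately show ?case using z by simp
qed simp

lemma measurable_query_spaceI:
  assumes "\<And>i. (\<lambda>h. q h i) \<in> borel_measurable M" "\<And>h. q h \<in> cball_d d R"
  shows "q \<in> measurable M (query_space d R)"
  unfolding query_space_def
  using assms by (intro measurable_restrict_space2 measurable_coordinatewise_then_product) auto

lemma agd_is_algorithm:
  assumes "0 \<le> r" "0 \<le> \<eta>" "r + \<eta> \<le> R"
  shows "is_algorithm d R (N * (d + 1)) (agd_query d r \<beta> \<eta>) (\<lambda>h. fst (agd d r \<beta> \<eta> h N))"
  unfolding is_algorithm_def
proof (intro conjI allI impI)
  fix t
  have t: "t div (d + 1) * (d + 1) \<le> t" by (rule div_times_less_eq_dividend)
  show "agd_query d r \<beta> \<eta> t \<in> measurable (history_space d R t) (query_space d R)"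
  proof (rule measurable_query_spaceI)
    show "agd_query d r \<beta> \<eta> t h \<in> cball_d d R" for h
      using agd_query_in_cball[OF assms(1,2), of d \<beta> t h] assms(3) by (auto simp: cball_d_def)
    show "(\<lambda>h. agd_query d r \<beta> \<eta> t h i) \<in> borel_measurable (history_space d R t)" for i
      unfolding agd_query_def agd_centre_def Let_def
      by (intro borel_measurable_add borel_measurable_times borel_measurable_const
        measurable_agd[OF t, THEN conjunct1] measurable_agd[OF t, THEN conjunct2])
  qed
next
  show "(\<lambda>h. fst (agd d r \<beta> \<eta> h N)) \<in> measurable (history_space d R (N * (d + 1))) (query_space d R)"
  proof (rule measurable_query_spaceI)
    show "fst (agd d r \<beta> \<eta> h N) \<in> cball_d d R" for h
      using agd_in_cball[OF assms(1), of d \<beta> \<eta> h N] assms by (auto simp: cball_d_def)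
  qed (use measurable_agd in blast)
qed

section \<open>Error and budget of the algorithm\<close>

lemma history_nth: "t < T \<Longrightarrow> history Q f T t = (Q t (history Q f t), f (Q t (history Q f t)))"
  by (induction T) (auto simp: Let_def less_Suc_eq)

lemma history_prefix: "t' < t \<Longrightarrow> t \<le> T \<Longrightarrow> history Q f t t' = history Q f T t'"
  by (simp add: history_nth)

text \<open>Convexity makes the forward difference at least the partial derivative; descent makes
  the excess at most \<beta> * \<eta>.\<close>

lemma finite_difference_error:
  assumes convex: "\<And>a b. a \<in> Rd d \<Longrightarrow> b \<in> Rd d \<Longrightarrow> f a + inner_d d (G a) (b - a) \<le> f b"
    and lipschitz: "\<And>a b. a \<in> Rd d \<Longrightarrow> b \<in> Rd d \<Longrightarrow> norm_d d (G a - G b) \<le> \<beta> * norm_d d (a - b)"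
    and \<beta>: "0 \<le> \<beta>" and \<eta>: "0 < \<eta>" and y: "y \<in> Rd d" and i: "i < d"
  shows "\<bar>(f (\<lambda>j. y j + (if Suc i = Suc j then \<eta> else 0)) - f y) / \<eta> - G y i\<bar> \<le> \<beta> * \<eta>"
proof -
  define y' where "y' = (\<lambda>j. y j + (if Suc i = Suc j then \<eta> else 0))"
  have y': "y' \<in> Rd d" using y i by (auto simp: y'_def in_Rd_iff)
  have diff: "y' - y = (\<lambda>j. if Suc i = Suc j then \<eta> else 0)" by (simp add: y'_def fun_eq_iff)
  have inner: "inner_d d (G y) (y' - y) = \<eta> * G y i"
  proof -
    have "inner_d d (G y) (y' - y) = (\<Sum>j<d. if i = j then \<eta> * G y i else 0)"
      unfolding inner_d_def diff by (intro sum.cong) auto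
    then show ?thesis using i by simp
  qed
  have "norm_d d (y' - y) \<le> \<eta>" using norm_d_axis[of d "Suc i" \<eta>] \<eta> by (simp add: diff)
  then have "(norm_d d (y' - y))\<^sup>2 \<le> \<eta>\<^sup>2" by (intro power_mono) auto
  then have "\<beta> * (norm_d d (y' - y))\<^sup>2 \<le> \<beta> * \<eta>\<^sup>2"
    using \<beta> by (rule mult_left_mono)
  then have "f y' \<le> f y + \<eta> * G y i + \<beta> * \<eta>\<^sup>2"
    using descent_inequality[OF convex[OF y' y] lipschitz[OF y y']] inner by simp
  moreover have "f y + \<eta> * G y i \<le> f y'"
    using convex[OF y y'] inner by simp
  ultimately have "0 \<le> (f y' - f y) - \<eta> * G y i" "(f y' - f y) - \<eta> * G y i \<le> \<eta> * (\<beta> * \<eta>)"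
    by (simp_all add: power2_eq_square mult_ac)
  moreover have "(f y' - f y) / \<eta> - G y i = ((f y' - f y) - \<eta> * G y i) / \<eta>"
    using \<eta> by (simp add: field_simps)
  ultimately show ?thesis
    unfolding y'_def[symmetric] using \<eta> by (simp add: divide_le_eq mult.commute)
qed

lemma agd_output_error:
  assumes f: "f \<in> objective_class d R \<mu> \<beta>"
    and pos: "0 < R" "0 \<le> \<mu>" "0 < \<beta>" "0 < \<epsilon>" "0 < d" and N: "2 * (\<beta> * R\<^sup>2 / \<epsilon>) \<le> (real N)\<^sup>2" "0 < N"
    and \<eta>: "0 < \<eta>" "\<beta> * \<eta> * real d \<le> \<epsilon> / (4 * R)"
  defines "T \<equiv> N * (d + 1)" and "r \<equiv> R / 2"
  shows "f (output_point T (agd_query d r \<beta> \<eta>) (\<lambda>h. fst (agd d r \<beta> \<eta> h N)) f) - f (arg_min_on f (Rd d)) \<le> \<epsilon>"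
proof -
  obtain G where G: "\<forall>x\<in>Rd d. has_gradient d f (G x) x"
    "\<forall>x\<in>Rd d. \<forall>y\<in>Rd d. f y \<ge> f x + inner_d d (G x) (y - x) + \<mu> / 2 * (norm_d d (y - x))\<^sup>2 \<and>
       norm_d d (G x - G y) \<le> \<beta> * norm_d d (x - y)"
    and ex: "\<exists>!x. is_arg_min f (\<lambda>x. x \<in> Rd d) x" and ball: "arg_min_on f (Rd d) \<in> cball_d d r"
    using f by (auto simp: objective_class_def r_def)
  define a where "a = arg_min_on f (Rd d)"
  have a_min: "f a \<le> f b" if "b \<in> Rd d" for b
  proof -
    have "is_arg_min f (\<lambda>x. x \<in> Rd d) a"
      unfolding a_def arg_min_on_def arg_min_def using ex by (metis someI_ex)
    then show ?thesis using that by (simp add: is_arg_min_linorder)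
  qed
  have convex: "f x + inner_d d (G x) (y - x) \<le> f y" if "x \<in> Rd d" "y \<in> Rd d" for x y
  proof -
    have "0 \<le> \<mu> / 2 * (norm_d d (y - x))\<^sup>2" using pos by simp
    then show ?thesis using G(2) that by fastforce
  qed
  have lipschitz: "norm_d d (G x - G y) \<le> \<beta> * norm_d d (x - y)" if "x \<in> Rd d" "y \<in> Rd d" for x y
    using G(2) that by blast
  have r: "0 \<le> r" using pos by (simp add: r_def)
  define H where "H = history (agd_query d r \<beta> \<eta>) f T"
  have H: "snd (H t) = f (agd_query d r \<beta> \<eta> t H)" if "t < T" for t
  proof -
    have "agd_query d r \<beta> \<eta> t (history (agd_query d r \<beta> \<eta>) f t) = agd_query d r \<beta> \<eta> t H"
      unfolding H_def using that by (intro agd_query_cong history_prefix) auto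
    then show ?thesis using that by (simp add: H_def history_nth)
  qed
  define x where "x k = fst (agd d r \<beta> \<eta> H k)" for k
  define z where "z k = snd (agd d r \<beta> \<eta> H k)" for k
  define g where "g k = grad_estimate d \<eta> H k" for k
  define y where "y k = agd_centre d r \<beta> \<eta> H k" for k
  have Rd: "x k \<in> Rd d" "z k \<in> Rd d" "g k \<in> Rd d" "y k \<in> Rd d" for k
    using agd_in_cball[OF r, of d \<beta> \<eta> H k] agd_centre_in_cball[OF r, of d \<beta> \<eta> H k] grad_estimate_Rd
    by (auto simp: x_def z_def g_def y_def cball_d_def)
  have err: "norm_d d (g k - G (y k)) \<le> \<epsilon> / (4 * R)" if k: "k < N" for k
  proof -
    \<comment> \<open>The crude passage to the l1 norm costs a factor d, which a smaller \<eta>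
      absorbs: values are exact, so \<eta> is free.\<close>
    have "norm_d d (g k - G (y k)) \<le> (\<Sum>i<d. \<bar>g k i - G (y k) i\<bar>)"
      unfolding norm_d_def by (rule order_trans[OF L2_set_le_sum_abs]) simp
    also have "\<dots> \<le> (\<Sum>i<d. \<beta> * \<eta>)"
    proof (rule sum_mono)
      fix i assume "i \<in> {..<d}"
      then have i: "i < d" by simp
      have "Suc k * (d + 1) \<le> N * (d + 1)" using k by (intro mult_le_mono1) simp
      then have T: "k * (d + 1) + Suc i < T" "k * (d + 1) < T"
        using i by (simp_all add: T_def)
      have dm: "(k * (d + 1) + Suc i) div (d + 1) = k" "(k * (d + 1) + Suc i) mod (d + 1) = Suc i"
        "(k * (d + 1)) div (d + 1) = k" "(k * (d + 1)) mod (d + 1) = 0"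
        using i div_mult_self3[of "d + 1" k "Suc i"] mod_mult_self3[of k "d + 1" "Suc i"]
          div_mult_self3[of "d + 1" k 0] mod_mult_self3[of k "d + 1" 0] by simp_all
      have "g k i = (f (\<lambda>j. y k j + (if Suc i = Suc j then \<eta> else 0)) - f (y k)) / \<eta>"
        using i unfolding g_def grad_estimate_def H[OF T(1)] H[OF T(2)] agd_query_def dm y_def by simp
      then show "\<bar>g k i - G (y k) i\<bar> \<le> \<beta> * \<eta>"
        using finite_difference_error[OF convex lipschitz _ \<eta>(1) Rd(4) i] pos by simp
    qed
    also have "\<dots> \<le> \<epsilon> / (4 * R)" using \<eta>(2) by (simp add: mult_ac)
    finally show ?thesis .
  qed
  have "f (x N) - f a \<le> 4 * \<beta> * r\<^sup>2 / (real N)\<^sup>2 + 4 * r * (\<epsilon> / (4 * R))"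
  proof (rule accelerated_convergence[OF convex lipschitz pos(3) r _ a_min Rd(1-3)])
    show "a \<in> cball_d d r" using ball by (simp add: a_def)
    show "z 0 = (\<lambda>_. 0)" by (simp add: z_def)
    show "0 \<le> \<epsilon> / (4 * R)" using pos by simp
    show "norm_d d (g k - G (\<lambda>i. (1 - 2 / (real k + 2)) * x k i + 2 / (real k + 2) * z k i)) \<le> \<epsilon> / (4 * R)"
      if "k < N" for k
      using err[OF that] by (simp only: y_def agd_centre_def Let_def x_def z_def)
  qed (use N in \<open>simp_all add: x_def z_def g_def Let_def\<close>)
  \<comment> \<open>With r = R / 2, optimization and gradient error each get one half of
    \<epsilon>.\<close>
  also have "\<dots> = \<beta> * R\<^sup>2 / (real N)\<^sup>2 + \<epsilon> / 2"
    using pos by (simp add: r_def power_divide)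
  also have "\<beta> * R\<^sup>2 / (real N)\<^sup>2 \<le> \<epsilon> / 2"
    using N pos by (simp add: field_simps)
  finally show ?thesis
    by (simp add: output_point_def a_def x_def H_def)
qed

lemma agd_budget:
  assumes "0 < R" "0 < \<mu>" "0 < \<beta>" "0 < \<epsilon>" "0 < d"
  defines "K \<equiv> \<beta> * R\<^sup>2 / \<epsilon>"
  assumes K: "1 \<le> K"
  shows "\<exists>T Q Qout. is_algorithm d R T Q Qout \<and> real T \<le> 6 * real d * sqrt K \<and>
    (\<forall>f\<in>objective_class d R \<mu> \<beta>. f (output_point T Q Qout f) - f (arg_min_on f (Rd d)) \<le> \<epsilon>)"
proof -
  define N where "N = nat \<lceil>sqrt (2 * K)\<rceil>"
  \<comment> \<open>The first bound keeps the translated queries in the ball of radius R, the second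
    makes the gradient error at most \<epsilon> / (4 * R).\<close>
  define \<eta> where "\<eta> = min (R / 2) (\<epsilon> / (4 * R * \<beta> * real d))"
  have N: "sqrt (2 * K) \<le> real N" "real N \<le> sqrt (2 * K) + 1"
    unfolding N_def using K by (simp_all add: real_nat_ceiling_ge of_nat_ceiling)
  have "(sqrt (2 * K))\<^sup>2 \<le> (real N)\<^sup>2" using N K by (intro power_mono) auto
  then have N2: "2 * (\<beta> * R\<^sup>2 / \<epsilon>) \<le> (real N)\<^sup>2" using K by (simp add: K_def)
  have "0 < sqrt (2 * K)" using K by simp
  with N(1) have N0: "0 < N" by (cases N) auto
  have \<eta>: "0 < \<eta>" "R / 2 + \<eta> \<le> R"
    using assms by (simp_all add: \<eta>_def)
  have "\<beta> * real d * \<eta> \<le> \<beta> * real d * (\<epsilon> / (4 * R * \<beta> * real d))"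
    using assms by (intro mult_left_mono) (simp_all add: \<eta>_def)
  then have \<eta>': "\<beta> * \<eta> * real d \<le> \<epsilon> / (4 * R)"
    using assms by (simp add: field_simps)
  have "real (N * (d + 1)) \<le> (sqrt (2 * K) + 1) * (2 * real d)"
    unfolding of_nat_mult using N assms by (intro mult_mono) auto
  \<comment> \<open>The constant 6 is 3 from rounding up sqrt (2 * K), times 2 from d + 1 \<le> 2 *
    d.\<close>
  also have "\<dots> \<le> (3 * sqrt K) * (2 * real d)"
  proof (intro mult_right_mono)
    have "sqrt 2 \<le> 2" by (rule real_le_lsqrt) auto
    then have "sqrt 2 * sqrt K \<le> 2 * sqrt K" using K by (intro mult_right_mono) auto
    moreover have "1 \<le> sqrt K" using K by simp
    ultimately show "sqrt (2 * K) + 1 \<le> 3 * sqrt K" unfolding real_sqrt_mult by linarith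
  qed simp
  finally have "real (N * (d + 1)) \<le> 6 * real d * sqrt K" by (simp add: mult_ac)
  moreover have "is_algorithm d R (N * (d + 1)) (agd_query d (R / 2) \<beta> \<eta>) (\<lambda>h. fst (agd d (R / 2) \<beta> \<eta> h N))"
    using \<eta> assms by (intro agd_is_algorithm) auto
  ultimately show ?thesis
    using agd_output_error[OF _ assms(1) _ assms(3-5) N2 N0 \<eta>(1) \<eta>'] assms(2)
    by (intro exI conjI ballI) (auto simp: less_imp_le)
qed

subsection \<open>The minimax complexity\<close>

lemma minimax_complexity_ge:
  assumes "\<And>T Q Qout. is_algorithm d R T Q Qout \<Longrightarrow>
    (\<And>f. f \<in> objective_class d R \<mu> \<beta> \<Longrightarrow> f (output_point T Q Qout f) - f (arg_min_on f (Rd d)) \<le> \<epsilon>) \<Longrightarrow>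
    b \<le> real T"
  shows "ereal b \<le> ereal_of_enat (minimax_complexity \<epsilon> d R \<mu> \<beta>)"
proof (cases "minimax_complexity \<epsilon> d R \<mu> \<beta>")
  case (enat T)
  let ?S = "{enat T | T. \<exists>Q Qout. is_algorithm d R T Q Qout \<and>
     (SUP f \<in> objective_class d R \<mu> \<beta>.
        ereal (f (output_point T Q Qout f) - f (arg_min_on f (Rd d)))) \<le> ereal \<epsilon>}"
  have "Inf ?S = enat T" using enat by (simp only: minimax_complexity_def)
  \<comment> \<open>The set is nonempty as its infimum is finite, and \<open>enat\<close> is
    well-ordered, so the infimum is attained.\<close>
  then have "enat T \<in> ?S"
    by (metis (no_types, lifting) Inf_enat_def enat.distinct(1) LeastI_ex ex_in_conv)
  then obtain Q Qout where alg: "is_algorithm d R T Q Qout" and sup: "(SUP f \<in> objective_class d R \<mu> \<beta>.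
      ereal (f (output_point T Q Qout f) - f (arg_min_on f (Rd d)))) \<le> ereal \<epsilon>"
    by auto
  have "f (output_point T Q Qout f) - f (arg_min_on f (Rd d)) \<le> \<epsilon>" if "f \<in> objective_class d R \<mu> \<beta>" for f
    using sup that by (simp add: SUP_le_iff)
  then have "b \<le> real T" by (rule assms[OF alg])
  then show ?thesis using enat by simp
qed simp

lemma minimax_complexity_le:
  assumes "is_algorithm d R T Q Qout"
    and "\<And>f. f \<in> objective_class d R \<mu> \<beta> \<Longrightarrow> f (output_point T Q Qout f) - f (arg_min_on f (Rd d)) \<le> \<epsilon>"
  shows "minimax_complexity \<epsilon> d R \<mu> \<beta> \<le> enat T"
proof -
  have "(SUP f \<in> objective_class d R \<mu> \<beta>.
      ereal (f (output_point T Q Qout f) - f (arg_min_on f (Rd d)))) \<le> ereal \<epsilon>"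
    by (intro SUP_least) (simp add: assms(2))
  with assms(1) show ?thesis
    unfolding minimax_complexity_def by (intro Inf_lower) blast
qed

theorem corollary3p8:
  shows "\<exists>(c::real) (C::real) (c\<^sub>\<epsilon>::real) (d\<^sub>0::nat). 0 < c \<and> 0 < C \<and> 0 < c\<^sub>\<epsilon> \<and> 1 \<le> d\<^sub>0 \<and>
    (\<forall>(d::nat) (R::real) (\<mu>::real) (\<beta>::real) (\<epsilon>::real).
       d\<^sub>0 \<le> d \<longrightarrow> 0 < R \<longrightarrow> 0 < \<mu> \<longrightarrow> \<mu> \<le> \<beta> \<longrightarrow> 0 < \<epsilon> \<longrightarrow> \<epsilon> \<le> c\<^sub>\<epsilon> * \<beta> * R\<^sup>2 \<longrightarrow>
       \<beta> * R\<^sup>2 / \<epsilon> \<le> \<beta> / \<mu> \<longrightarrow>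
       \<beta> * R\<^sup>2 / \<epsilon> \<le> (real d / ln (exp 1 * real d)) powr (2 / 3) \<longrightarrow>
       ereal (c * real d * sqrt (\<beta> * R\<^sup>2 / \<epsilon>)) \<le> ereal_of_enat (minimax_complexity \<epsilon> d R \<mu> \<beta>) \<and>
       ereal_of_enat (minimax_complexity \<epsilon> d R \<mu> \<beta>) \<le> ereal (C * real d * sqrt (\<beta> * R\<^sup>2 / \<epsilon>)))"
proof (rule exI[of _ "1 / 1024"], rule exI[of _ 6], rule exI[of _ "1 / 1024"], rule exI[of _ 32],
    intro conjI allI impI)
  fix d :: nat and R \<mu> \<beta> \<epsilon> :: real
  assume d: "32 \<le> d" and pos: "0 < R" "0 < \<mu>" "0 < \<epsilon>" and \<mu>\<beta>: "\<mu> \<le> \<beta>"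
    and \<epsilon>: "\<epsilon> \<le> 1 / 1024 * \<beta> * R\<^sup>2" and kappa: "\<beta> * R\<^sup>2 / \<epsilon> \<le> \<beta> / \<mu>"
    and dim: "\<beta> * R\<^sup>2 / \<epsilon> \<le> (real d / ln (exp 1 * real d)) powr (2 / 3)"
  have \<beta>: "0 < \<beta>" using pos \<mu>\<beta> by linarith
  \<comment> \<open>This is the purpose of the bound on \<epsilon>: sqrt K \<ge> 32 gives a chain
    with at least one link.\<close>
  have K: "1024 \<le> \<beta> * R\<^sup>2 / \<epsilon>" using \<epsilon> pos by (simp add: field_simps)
  have "\<beta> * (\<mu> * R\<^sup>2) \<le> \<beta> * \<epsilon>" using kappa pos by (simp add: field_simps)
  then have \<mu>R: "\<mu> * R\<^sup>2 \<le> \<epsilon>" using \<beta> by simp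
  show "ereal (1 / 1024 * real d * sqrt (\<beta> * R\<^sup>2 / \<epsilon>)) \<le> ereal_of_enat (minimax_complexity \<epsilon> d R \<mu> \<beta>)"
  proof (rule minimax_complexity_ge)
    fix T Q Qout
    assume "is_algorithm d R T Q Qout"
      and "\<And>f. f \<in> objective_class d R \<mu> \<beta> \<Longrightarrow> f (output_point T Q Qout f) - f (arg_min_on f (Rd d)) \<le> \<epsilon>"
    then show "1 / 1024 * real d * sqrt (\<beta> * R\<^sup>2 / \<epsilon>) \<le> real T"
      using budget_lower_bound[of d R T Q Qout \<mu> \<beta> \<epsilon>] d pos \<mu>R K dim by simp
  qed
  obtain T Q Qout where T: "is_algorithm d R T Q Qout" "real T \<le> 6 * real d * sqrt (\<beta> * R\<^sup>2 / \<epsilon>)"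
    "\<forall>f\<in>objective_class d R \<mu> \<beta>. f (output_point T Q Qout f) - f (arg_min_on f (Rd d)) \<le> \<epsilon>"
    using agd_budget[OF pos(1,2) \<beta> pos(3), of d] d K by force
  have "minimax_complexity \<epsilon> d R \<mu> \<beta> \<le> enat T"
    using T by (intro minimax_complexity_le) auto
  then have "ereal_of_enat (minimax_complexity \<epsilon> d R \<mu> \<beta>) \<le> ereal_of_enat (enat T)"
    by (simp only: ereal_of_enat_le_iff)
  also have "\<dots> \<le> ereal (6 * real d * sqrt (\<beta> * R\<^sup>2 / \<epsilon>))" using T(2) by simp
  finally show "ereal_of_enat (minimax_complexity \<epsilon> d R \<mu> \<beta>) \<le> ereal (6 * real d * sqrt (\<beta> * R\<^sup>2 / \<epsilon>))" .
qed simp_all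

end
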